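(* Let $(\bar M,\bar g_0,\bar J)$ be an indefinite Kaehler manifold, $(M,g_0)$ a totally geodesic lightlike hypersurface of $\bar M$ with conformal structure $c=[g_0]_0$ and screen distribution $S(TM)=\left(\bar J(TM^\perp)\oplus\bar J(\mathrm{tr}(TM))\right)\perp D_0$, whose second fundamental form is symmetric on $S(TM)$ (so that $S(TM)$ is integrable). Let $D^{\bar J}$ be the Weyl screen structure on $(M,c,S(TM))$ whose associated 1-form with respect to $g=e^{-2f}g_0\in c$ is $\theta_g=\theta_0+df$. Then the Weyl structure $D^{\bar J}$ relative to $(M,c,S(TM))$ is closed if and only if the 1-forms $\theta_0$ and $\varphi_{g_0}$ are proportional (i.e. $\varphi_{g_0}=k\,\theta_0$ for some function $k$).
   Context: $(\bar M,\bar g_0,\bar J)$ has real dimension $2m$, $m>1$, and $\bar g_0$ has index $2\nu$, $0<\nu<m$; Kaehler means $\bar J$ is an orthogonal almost complex structure parallel for the Levi-Civita connection $\bar\nabla$ of $\bar g_0$. $M$ is a hypersurface on which the induced metric $g_0$ is degenerate (of constant corank one); $TM^\perp=\ker g_0$, with nowhere vanishing (local) section $\xi$. Given a screen distribution $S(TM)$ (complement of $TM^\perp$ in $TM$), $\mathrm{tr}(TM)$ is the line bundle spanned by the unique $N$ with $\bar g_0(N,\xi)=1$, $\bar g_0(N,N)=0$, $\bar g_0(N,W)=0$ for $W\in\Gamma(S(TM))$. $S(TM)$ is chosen to contain $\bar J(TM^\perp)\oplus\bar J(\mathrm{tr}(TM))$, and $D_0$ is the nondegenerate $\bar J$-invariant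 distribution with $S(TM)=\left(\bar J(TM^\perp)\oplus\bar J(\mathrm{tr}(TM))\right)\perp D_0$. Put $V=-\bar J\xi$, $\theta_0(X)=g_0(X,V)$, $\eta=\bar g_0(N,\cdot)$, and let $P:TM\to S(TM)$ be the projection along $TM^\perp$. $D^{g_0}$ is the induced connection on $M$: $\bar\nabla_XY=D^{g_0}_XY+B(X,Y)N$. $M$ is totally geodesic: $B=0$; then $D^{g_0}_X\xi=\varphi_{g_0}(X)\xi$ defines the 1-form $\varphi_{g_0}$. $c=[g_0]_0$ is the set of metrics $g=e^{-2f}g_0$ with $X(f)=0$ for $X\in TM^\perp$. A Weyl structure on $(M,c)$ is a torsion-free connection $D$ such that for every $g\in c$ there is a unique 1-form $\theta_g$ with $Dg=-2\theta_g\otimes g$; it is a Weyl screen structure if in addition $D_XPY\in\Gamma(S(TM))$ for all $X,Y$; it is closed if $d\theta_g=0$ for one (equivalently every) $g\in c$. The second fundamental form $C$ of $S(TM)$ relative to a torsion-free $g$-compatible connection $D^g$ is defined by $D^g_XPY=\overset{\star}{\nabla}_XPY+C(X,PY)\xi$, $\overset{\star}{\nabla}_XPY\in\Gamma(S(TM))$. The structure $D^{\bar J}$ is given, for $g\in c$, by $$D^{\bar J}_XY=D^g_XY+\theta_g(X)Y+\theta_g(Y)X-g(X,Y)\theta_g^{\sharp_g}-S(X,Y)\xi,\qquad \theta_g=\theta_0+df,$$ with $S$ the symmetric tensor such that $S(\xi,\xi)=0$ and $S(X,Y)=C(X,Y)+\eta(X)\theta_g(Y)$ for $X\in\Gamma(TM)$,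 $Y\in\Gamma(S(TM))$; $\theta_g^{\sharp_g}$ is the section of $S(TM)$ with $\theta_g=g(\theta_g^{\sharp_g},\cdot)$. *)

theory Defs
  imports "HOL-Analysis.Analysis" "HOL-Library.Function_Algebras"
begin

section \<open>Pointwise vector space structure on functions\<close>

instantiation "fun" :: (type, real_vector) real_vector
begin

definition scaleR_fun :: "real \<Rightarrow> ('a \<Rightarrow> 'b) \<Rightarrow> 'a \<Rightarrow> 'b" where
  "scaleR_fun c f = (\<lambda>x. c *\<^sub>R f x)"

instance
  by standard (simp_all add: scaleR_fun_def fun_eq_iff scaleR_add_right scaleR_add_left)

end

section \<open>Smooth maps between Euclidean spaces\<close>

text \<open>All the sets \<open>U\<close> below are open, so derivatives are taken at interior points.\<close>

primrec Ck_on :: "nat \<Rightarrow> 'e::real_normed_vector set \<Rightarrow> ('e \<Rightarrow> 'f::real_normed_vector) \<Rightarrow> bool" where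
  "Ck_on 0 U f \<longleftrightarrow> continuous_on U f"
| "Ck_on (Suc k) U f \<longleftrightarrow> (\<forall>x\<in>U. f differentiable (at x)) \<and>
     (\<forall>v. Ck_on k U (\<lambda>x. frechet_derivative f (at x) v))"

definition smooth_on :: "'e::real_normed_vector set \<Rightarrow> ('e \<Rightarrow> 'f::real_normed_vector) \<Rightarrow> bool" where
  "smooth_on U f \<longleftrightarrow> (\<forall>k. Ck_on k U f)"

section \<open>Smooth manifolds\<close>

text \<open>A manifold is a whole type, Hausdorff and second countable by its type classes, together with
  an atlas; it is modelled on a Euclidean space, whose \<open>DIM\<close> is its dimension.\<close>

type_synonym ('a, 'e) atlas = "('a set \<times> ('a \<Rightarrow> 'e)) set"

definition smooth_atlas ::
  "('a::{t2_space, second_countable_topology}, 'e::euclidean_space) atlas \<Rightarrow> bool" where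
  "smooth_atlas A \<longleftrightarrow>
     (\<Union>(U, \<phi>)\<in>A. U) = UNIV \<and>
     (\<forall>(U, \<phi>)\<in>A. open U \<and> open (\<phi> ` U) \<and> homeomorphism U (\<phi> ` U) \<phi> (inv_into U \<phi>)) \<and>
     (\<forall>(U, \<phi>)\<in>A. \<forall>(W, \<psi>)\<in>A. smooth_on (\<phi> ` (U \<inter> W)) (\<psi> \<circ> inv_into U \<phi>))"

definition smooth_fun :: "('a::topological_space, 'e::euclidean_space) atlas \<Rightarrow> 'a set \<Rightarrow> ('a \<Rightarrow> real) \<Rightarrow> bool" where
  "smooth_fun A W f \<longleftrightarrow> (\<forall>(U, \<phi>)\<in>A. smooth_on (\<phi> ` (U \<inter> W)) (f \<circ> inv_into U \<phi>))"

definition smooth_near :: "('a::topological_space, 'e::euclidean_space) atlas \<Rightarrow> 'a \<Rightarrow> ('a \<Rightarrow> real) \<Rightarrow> bool" where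
  "smooth_near A p f \<longleftrightarrow> (\<exists>W. open W \<and> p \<in> W \<and> smooth_fun A W f)"

definition smooth_map :: "('b::topological_space, 'f::euclidean_space) atlas \<Rightarrow>
    ('a::topological_space, 'e::euclidean_space) atlas \<Rightarrow> ('b \<Rightarrow> 'a) \<Rightarrow> bool" where
  "smooth_map A A' \<iota> \<longleftrightarrow> continuous_on UNIV \<iota> \<and>
     (\<forall>(U, \<phi>)\<in>A. \<forall>(W, \<psi>)\<in>A'. smooth_on (\<phi> ` (U \<inter> \<iota> -` W)) (\<psi> \<circ> \<iota> \<circ> inv_into U \<phi>))"

section \<open>Tangent vectors and vector fields\<close>

text \<open>A tangent vector at \<open>p\<close> is the operator \<open>f \<mapsto> (f \<circ> \<gamma>)'(0)\<close> of differentiation along a curve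
  through \<open>p\<close> (a straight line in some chart), on the functions that are smooth near \<open>p\<close>. It is set
  to \<open>0\<close> on all other functions, so that equality of functionals is equality of tangent vectors.\<close>

type_synonym 'a tangent = "('a \<Rightarrow> real) \<Rightarrow> real"
type_synonym 'a vfield = "'a \<Rightarrow> 'a tangent"

definition chart_vector :: "('a::topological_space, 'e::euclidean_space) atlas \<Rightarrow>
    'a set \<times> ('a \<Rightarrow> 'e) \<Rightarrow> 'a \<Rightarrow> 'e \<Rightarrow> 'a tangent" where
  "chart_vector A c p u = (\<lambda>f. if smooth_near A p f
     then frechet_derivative (f \<circ> inv_into (fst c) (snd c)) (at (snd c p)) u else 0)"

definition tangent_space :: "('a::topological_space, 'e::euclidean_space) atlas \<Rightarrow> 'a \<Rightarrow> 'a tangent set" where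
  "tangent_space A p = {chart_vector A c p u | c u. c \<in> A \<and> p \<in> fst c}"

text \<open>Vector fields are total functions of which only the values on an open set \<open>U\<close> matter; all
  notions below are about smooth local sections over arbitrary open sets.\<close>

definition vector_field_on :: "('a::topological_space, 'e::euclidean_space) atlas \<Rightarrow> 'a set \<Rightarrow> 'a vfield \<Rightarrow> bool" where
  "vector_field_on A U X \<longleftrightarrow> (\<forall>p\<in>U. X p \<in> tangent_space A p) \<and>
     (\<forall>W f. open W \<and> W \<subseteq> U \<and> smooth_fun A W f \<longrightarrow> smooth_fun A W (\<lambda>p. X p f))"

definition lie_bracket :: "('a::topological_space, 'e::euclidean_space) atlas \<Rightarrow> 'a vfield \<Rightarrow> 'a vfield \<Rightarrow> 'a vfield" where
  "lie_bracket A X Y p = (\<lambda>f. if smooth_near A p f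
     then X p (\<lambda>q. Y q f) - Y p (\<lambda>q. X q f) else 0)"

definition tangent_map :: "('a::topological_space, 'e::euclidean_space) atlas \<Rightarrow> ('b \<Rightarrow> 'a) \<Rightarrow>
    'b \<Rightarrow> 'b tangent \<Rightarrow> 'a tangent" where
  "tangent_map A' \<iota> p v = (\<lambda>f. if smooth_near A' (\<iota> p) f then v (f \<circ> \<iota>) else 0)"

definition immersion :: "('b::topological_space, 'f::euclidean_space) atlas \<Rightarrow>
    ('a::topological_space, 'e::euclidean_space) atlas \<Rightarrow> ('b \<Rightarrow> 'a) \<Rightarrow> bool" where
  "immersion A A' \<iota> \<longleftrightarrow> smooth_map A A' \<iota> \<and>
     (\<forall>p. inj_on (tangent_map A' \<iota> p) (tangent_space A p))"

text \<open>A smooth distribution: locally spanned by a smooth frame.\<close>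

definition distribution :: "('a::topological_space, 'e::euclidean_space) atlas \<Rightarrow> ('a \<Rightarrow> 'a tangent set) \<Rightarrow> bool" where
  "distribution A S \<longleftrightarrow> (\<forall>p. \<exists>U k (E :: nat \<Rightarrow> 'a vfield). open U \<and> p \<in> U \<and>
     (\<forall>j<k. vector_field_on A U (E j)) \<and>
     (\<forall>q\<in>U. inj_on (\<lambda>j. E j q) {..<k} \<and> independent ((\<lambda>j. E j q) ` {..<k}) \<and>
        S q = span ((\<lambda>j. E j q) ` {..<k})))"

definition section_on :: "('a::topological_space, 'e::euclidean_space) atlas \<Rightarrow> ('a \<Rightarrow> 'a tangent set) \<Rightarrow>
    'a set \<Rightarrow> 'a vfield \<Rightarrow> bool" where
  "section_on A S U X \<longleftrightarrow> vector_field_on A U X \<and> (\<forall>p\<in>U. X p \<in> S p)"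

section \<open>Tensor fields\<close>

type_synonym 'a form1 = "'a \<Rightarrow> 'a tangent \<Rightarrow> real"
type_synonym 'a form2 = "'a \<Rightarrow> 'a tangent \<Rightarrow> 'a tangent \<Rightarrow> real"

definition one_form :: "('a::topological_space, 'e::euclidean_space) atlas \<Rightarrow> 'a form1 \<Rightarrow> bool" where
  "one_form A \<theta> \<longleftrightarrow>
     (\<forall>p. \<forall>u\<in>tangent_space A p. \<forall>v\<in>tangent_space A p. \<forall>a.
        \<theta> p (a *\<^sub>R u + v) = a * \<theta> p u + \<theta> p v) \<and>
     (\<forall>U X. open U \<and> vector_field_on A U X \<longrightarrow> smooth_fun A U (\<lambda>p. \<theta> p (X p)))"

definition ext_deriv :: "('a::topological_space, 'e::euclidean_space) atlas \<Rightarrow> 'a form1 \<Rightarrow>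
    'a vfield \<Rightarrow> 'a vfield \<Rightarrow> 'a \<Rightarrow> real" where
  "ext_deriv A \<theta> X Y p =
     X p (\<lambda>q. \<theta> q (Y q)) - Y p (\<lambda>q. \<theta> q (X q)) - \<theta> p (lie_bracket A X Y p)"

definition closed_form :: "('a::topological_space, 'e::euclidean_space) atlas \<Rightarrow> 'a form1 \<Rightarrow> bool" where
  "closed_form A \<theta> \<longleftrightarrow> (\<forall>U X Y. open U \<and> vector_field_on A U X \<and> vector_field_on A U Y \<longrightarrow>
     (\<forall>p\<in>U. ext_deriv A \<theta> X Y p = 0))"

definition sym_tensor :: "('a::topological_space, 'e::euclidean_space) atlas \<Rightarrow> 'a form2 \<Rightarrow> bool" where
  "sym_tensor A g \<longleftrightarrow>
     (\<forall>p. \<forall>u\<in>tangent_space A p. \<forall>v\<in>tangent_space A p. g p u v = g p v u) \<and>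
     (\<forall>p. \<forall>u\<in>tangent_space A p. \<forall>v\<in>tangent_space A p. \<forall>w\<in>tangent_space A p. \<forall>a.
        g p (a *\<^sub>R u + v) w = a * g p u w + g p v w) \<and>
     (\<forall>U X Y. open U \<and> vector_field_on A U X \<and> vector_field_on A U Y \<longrightarrow>
        smooth_fun A U (\<lambda>p. g p (X p) (Y p)))"

definition endo_field :: "('a::topological_space, 'e::euclidean_space) atlas \<Rightarrow>
    ('a \<Rightarrow> 'a tangent \<Rightarrow> 'a tangent) \<Rightarrow> bool" where
  "endo_field A J \<longleftrightarrow>
     (\<forall>p. \<forall>u\<in>tangent_space A p. J p u \<in> tangent_space A p) \<and>
     (\<forall>p. \<forall>u\<in>tangent_space A p. \<forall>v\<in>tangent_space A p. \<forall>a.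
        J p (a *\<^sub>R u + v) = a *\<^sub>R J p u + J p v) \<and>
     (\<forall>U X. open U \<and> vector_field_on A U X \<longrightarrow> vector_field_on A U (\<lambda>p. J p (X p)))"

definition metric_radical :: "('a::topological_space, 'e::euclidean_space) atlas \<Rightarrow> 'a form2 \<Rightarrow> 'a \<Rightarrow> 'a tangent set" where
  "metric_radical A g p = {u \<in> tangent_space A p. \<forall>v\<in>tangent_space A p. g p u v = 0}"

text \<open>The index at \<open>p\<close> is the largest dimension of a negative definite subspace.\<close>

definition has_index :: "('a::topological_space, 'e::euclidean_space) atlas \<Rightarrow> 'a form2 \<Rightarrow> 'a \<Rightarrow> nat \<Rightarrow> bool" where
  "has_index A g p k \<longleftrightarrow>
     (let neg = {W. subspace W \<and> W \<subseteq> tangent_space A p \<and> (\<forall>w\<in>W. w \<noteq> 0 \<longrightarrow> g p w w < 0)}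
      in (\<exists>W\<in>neg. dim W = k) \<and> (\<forall>W\<in>neg. dim W \<le> k))"

definition semi_riemannian :: "('a::topological_space, 'e::euclidean_space) atlas \<Rightarrow> 'a form2 \<Rightarrow> nat \<Rightarrow> bool" where
  "semi_riemannian A g k \<longleftrightarrow> sym_tensor A g \<and> (\<forall>p. metric_radical A g p = {0} \<and> has_index A g p k)"

section \<open>Connections\<close>

text \<open>A connection acts on local smooth sections over every open set; linearity over functions that
  are only smooth on \<open>U\<close> forces \<open>D X Y\<close> on \<open>U\<close> to depend only on \<open>X\<close>, \<open>Y\<close> on \<open>U\<close>.\<close>

type_synonym 'a conn = "'a vfield \<Rightarrow> 'a vfield \<Rightarrow> 'a vfield"

definition connection :: "('a::topological_space, 'e::euclidean_space) atlas \<Rightarrow> 'a conn \<Rightarrow> bool" where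
  "connection A D \<longleftrightarrow> (\<forall>U X Y Z f. open U \<and> vector_field_on A U X \<and> vector_field_on A U Y \<and>
     vector_field_on A U Z \<and> smooth_fun A U f \<longrightarrow>
       vector_field_on A U (D X Y) \<and>
       (\<forall>p\<in>U. D (\<lambda>q. f q *\<^sub>R X q + Y q) Z p = f p *\<^sub>R D X Z p + D Y Z p \<and>
              D X (\<lambda>q. f q *\<^sub>R Y q + Z q) p = f p *\<^sub>R D X Y p + X p f *\<^sub>R Y p + D X Z p))"

definition torsion_free :: "('a::topological_space, 'e::euclidean_space) atlas \<Rightarrow> 'a conn \<Rightarrow> bool" where
  "torsion_free A D \<longleftrightarrow> (\<forall>U X Y. open U \<and> vector_field_on A U X \<and> vector_field_on A U Y \<longrightarrow>
     (\<forall>p\<in>U. D X Y p - D Y X p = lie_bracket A X Y p))"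

definition cov_deriv_metric :: "'a conn \<Rightarrow> 'a form2 \<Rightarrow> 'a vfield \<Rightarrow> 'a vfield \<Rightarrow> 'a vfield \<Rightarrow> 'a \<Rightarrow> real" where
  "cov_deriv_metric D g X Y Z p =
     X p (\<lambda>q. g q (Y q) (Z q)) - g p (D X Y p) (Z p) - g p (Y p) (D X Z p)"

definition metric_compatible :: "('a::topological_space, 'e::euclidean_space) atlas \<Rightarrow> 'a form2 \<Rightarrow> 'a conn \<Rightarrow> bool" where
  "metric_compatible A g D \<longleftrightarrow> (\<forall>U X Y Z. open U \<and> vector_field_on A U X \<and> vector_field_on A U Y \<and>
     vector_field_on A U Z \<longrightarrow> (\<forall>p\<in>U. cov_deriv_metric D g X Y Z p = 0))"

definition levi_civita :: "('a::topological_space, 'e::euclidean_space) atlas \<Rightarrow> 'a form2 \<Rightarrow> 'a conn \<Rightarrow> bool" where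
  "levi_civita A g D \<longleftrightarrow> connection A D \<and> torsion_free A D \<and> metric_compatible A g D"

definition parallel_endo :: "('a::topological_space, 'e::euclidean_space) atlas \<Rightarrow> 'a conn \<Rightarrow>
    ('a \<Rightarrow> 'a tangent \<Rightarrow> 'a tangent) \<Rightarrow> bool" where
  "parallel_endo A D J \<longleftrightarrow> (\<forall>U X Y. open U \<and> vector_field_on A U X \<and> vector_field_on A U Y \<longrightarrow>
     (\<forall>p\<in>U. D X (\<lambda>q. J q (Y q)) p = J p (D X Y p)))"

text \<open>\<open>k\<close> is the index of \<open>g\<close>, and \<open>D\<close> its Levi-Civita connection.\<close>

definition indefinite_kaehler :: "('a::topological_space, 'e::euclidean_space) atlas \<Rightarrow> 'a form2 \<Rightarrow>
    ('a \<Rightarrow> 'a tangent \<Rightarrow> 'a tangent) \<Rightarrow> 'a conn \<Rightarrow> nat \<Rightarrow> bool" where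
  "indefinite_kaehler A g J D k \<longleftrightarrow> semi_riemannian A g k \<and> levi_civita A g D \<and> endo_field A J \<and>
     (\<forall>p. \<forall>u\<in>tangent_space A p. J p (J p u) = - u) \<and>
     (\<forall>p. \<forall>u\<in>tangent_space A p. \<forall>v\<in>tangent_space A p. g p (J p u) (J p v) = g p u v) \<and>
     parallel_endo A D J"

section \<open>Lightlike hypersurfaces\<close>

text \<open>In this section \<open>A\<close>, \<open>A'\<close> are the atlases of the hypersurface and of the ambient manifold,
  \<open>\<iota>\<close> is the immersion and \<open>g'\<close> the ambient metric.\<close>

definition induced_metric :: "('a::topological_space, 'e::euclidean_space) atlas \<Rightarrow> ('b \<Rightarrow> 'a) \<Rightarrow>
    'a form2 \<Rightarrow> 'b form2" where
  "induced_metric A' \<iota> g' p u v = g' (\<iota> p) (tangent_map A' \<iota> p u) (tangent_map A' \<iota> p v)"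

definition lightlike :: "('b::topological_space, 'f::euclidean_space) atlas \<Rightarrow> 'b form2 \<Rightarrow> bool" where
  "lightlike A g \<longleftrightarrow> (\<forall>p. dim (metric_radical A g p) = 1)"

definition screen_distribution :: "('b::topological_space, 'f::euclidean_space) atlas \<Rightarrow> 'b form2 \<Rightarrow>
    ('b \<Rightarrow> 'b tangent set) \<Rightarrow> bool" where
  "screen_distribution A g S \<longleftrightarrow> distribution A S \<and>
     (\<forall>p. S p \<inter> metric_radical A g p = {0} \<and>
          {x + y | x y. x \<in> S p \<and> y \<in> metric_radical A g p} = tangent_space A p)"

definition screen_proj :: "('b::topological_space, 'f::euclidean_space) atlas \<Rightarrow> 'b form2 \<Rightarrow>
    ('b \<Rightarrow> 'b tangent set) \<Rightarrow> 'b \<Rightarrow> 'b tangent \<Rightarrow> 'b tangent" where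
  "screen_proj A g S p v = (THE s. s \<in> S p \<and> v - s \<in> metric_radical A g p)"

text \<open>These conditions determine \<open>N\<close>, which is therefore automatically smooth.\<close>

definition transversal_section :: "('a::topological_space, 'e::euclidean_space) atlas \<Rightarrow> 'a form2 \<Rightarrow>
    ('b \<Rightarrow> 'a) \<Rightarrow> ('b \<Rightarrow> 'b tangent set) \<Rightarrow> 'b vfield \<Rightarrow> ('b \<Rightarrow> 'a tangent) \<Rightarrow> bool" where
  "transversal_section A' g' \<iota> S \<xi> N \<longleftrightarrow> (\<forall>p. N p \<in> tangent_space A' (\<iota> p) \<and>
     g' (\<iota> p) (N p) (tangent_map A' \<iota> p (\<xi> p)) = 1 \<and> g' (\<iota> p) (N p) (N p) = 0 \<and>
     (\<forall>w\<in>S p. g' (\<iota> p) (N p) (tangent_map A' \<iota> p w) = 0))"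

text \<open>\<open>S(TM) = (J(TM\<^sup>\<bottom>) \<oplus> J(tr(TM))) \<bottom> D\<^sub>0\<close>, read inside the ambient tangent spaces.\<close>

definition screen_splitting :: "('b::topological_space, 'f::euclidean_space) atlas \<Rightarrow>
    ('a::topological_space, 'e::euclidean_space) atlas \<Rightarrow> ('b \<Rightarrow> 'a) \<Rightarrow> 'a form2 \<Rightarrow>
    ('a \<Rightarrow> 'a tangent \<Rightarrow> 'a tangent) \<Rightarrow> ('b \<Rightarrow> 'a tangent) \<Rightarrow>
    ('b \<Rightarrow> 'b tangent set) \<Rightarrow> ('b \<Rightarrow> 'b tangent set) \<Rightarrow> bool" where
  "screen_splitting A A' \<iota> g' J N S D\<^sub>0 \<longleftrightarrow> distribution A D\<^sub>0 \<and>
     (\<forall>p. let JR = (\<lambda>u. J (\<iota> p) (tangent_map A' \<iota> p u)) ` metric_radical A (induced_metric A' \<iota> g') p;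
              JT = J (\<iota> p) ` span {N p};
              E = tangent_map A' \<iota> p ` D\<^sub>0 p
          in tangent_map A' \<iota> p ` S p = {x + y + z | x y z. x \<in> JR \<and> y \<in> JT \<and> z \<in> E} \<and>
             JR \<inter> JT = {0} \<and> {x + y | x y. x \<in> JR \<and> y \<in> JT} \<inter> E = {0} \<and>
             (\<forall>x\<in>JR \<union> JT. \<forall>z\<in>E. g' (\<iota> p) x z = 0) \<and>
             (\<forall>z\<in>E. (\<forall>w\<in>E. g' (\<iota> p) z w = 0) \<longrightarrow> z = 0) \<and>
             J (\<iota> p) ` E = E)"

definition related_near :: "('a::topological_space, 'e::euclidean_space) atlas \<Rightarrow>
    ('b::topological_space \<Rightarrow> 'a) \<Rightarrow> 'b \<Rightarrow> 'b vfield \<Rightarrow> 'a vfield \<Rightarrow> bool" where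
  "related_near A' \<iota> p X X' \<longleftrightarrow>
     (\<exists>U. open U \<and> p \<in> U \<and> (\<forall>q\<in>U. X' (\<iota> q) = tangent_map A' \<iota> q (X q)))"

text \<open>The Gauss formula for the ambient connection \<open>D'\<close>, whose values on tangent fields of the
  hypersurface are computed by means of arbitrary local extensions \<open>X'\<close>, \<open>Y'\<close>.\<close>

definition induced_connection :: "('b::topological_space, 'f::euclidean_space) atlas \<Rightarrow>
    ('a::topological_space, 'e::euclidean_space) atlas \<Rightarrow> ('b \<Rightarrow> 'a) \<Rightarrow> 'a conn \<Rightarrow>
    ('b \<Rightarrow> 'a tangent) \<Rightarrow> 'b conn \<Rightarrow> 'b form2 \<Rightarrow> bool" where
  "induced_connection A A' \<iota> D' N D B \<longleftrightarrow> connection A D \<and> sym_tensor A B \<and>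
     (\<forall>U X Y W X' Y' p. open U \<and> p \<in> U \<and> vector_field_on A U X \<and> vector_field_on A U Y \<and>
        open W \<and> \<iota> p \<in> W \<and> vector_field_on A' W X' \<and> vector_field_on A' W Y' \<and>
        related_near A' \<iota> p X X' \<and> related_near A' \<iota> p Y Y' \<longrightarrow>
        D' X' Y' (\<iota> p) = tangent_map A' \<iota> p (D X Y p) + B p (X p) (Y p) *\<^sub>R N p)"

definition totally_geodesic :: "('b::topological_space, 'f::euclidean_space) atlas \<Rightarrow> 'b form2 \<Rightarrow> bool" where
  "totally_geodesic A B \<longleftrightarrow> (\<forall>p. \<forall>u\<in>tangent_space A p. \<forall>v\<in>tangent_space A p. B p u v = 0)"

text \<open>\<open>screen_sff A g S \<xi> D X Y\<close> is \<open>C(X, PY)\<close>, the \<open>\<xi>\<close>-component of \<open>D\<^sub>X PY\<close>.\<close>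

definition screen_sff :: "('b::topological_space, 'f::euclidean_space) atlas \<Rightarrow> 'b form2 \<Rightarrow>
    ('b \<Rightarrow> 'b tangent set) \<Rightarrow> 'b vfield \<Rightarrow> 'b conn \<Rightarrow> 'b vfield \<Rightarrow> 'b vfield \<Rightarrow> 'b \<Rightarrow> real" where
  "screen_sff A g S \<xi> D X Y p =
     (THE c. D X (\<lambda>q. screen_proj A g S q (Y q)) p - c *\<^sub>R \<xi> p \<in> S p)"

definition screen_sff_symmetric :: "('b::topological_space, 'f::euclidean_space) atlas \<Rightarrow> 'b form2 \<Rightarrow>
    ('b \<Rightarrow> 'b tangent set) \<Rightarrow> 'b vfield \<Rightarrow> 'b conn \<Rightarrow> bool" where
  "screen_sff_symmetric A g S \<xi> D \<longleftrightarrow>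
     (\<forall>U X Y. open U \<and> section_on A S U X \<and> section_on A S U Y \<longrightarrow>
        (\<forall>p\<in>U. screen_sff A g S \<xi> D X Y p = screen_sff A g S \<xi> D Y X p))"

definition sharp :: "('b::topological_space, 'f::euclidean_space) atlas \<Rightarrow> ('b \<Rightarrow> 'b tangent set) \<Rightarrow>
    'b form2 \<Rightarrow> 'b form1 \<Rightarrow> 'b vfield" where
  "sharp A S g \<theta> p = (THE s. s \<in> S p \<and> (\<forall>v\<in>tangent_space A p. g p s v = \<theta> p v))"

section \<open>Weyl structures\<close>

definition conformal_exponent :: "('b::topological_space, 'f::euclidean_space) atlas \<Rightarrow> 'b form2 \<Rightarrow>
    ('b \<Rightarrow> real) \<Rightarrow> bool" where
  "conformal_exponent A g f \<longleftrightarrow> smooth_fun A UNIV f \<and> (\<forall>p. \<forall>u\<in>metric_radical A g p. u f = 0)"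

definition rescale :: "('b \<Rightarrow> real) \<Rightarrow> 'b form2 \<Rightarrow> 'b form2" where
  "rescale f g p u v = exp (- 2 * f p) * g p u v"

definition conformal_class :: "('b::topological_space, 'f::euclidean_space) atlas \<Rightarrow> 'b form2 \<Rightarrow> 'b form2 set" where
  "conformal_class A g = {rescale f g | f. conformal_exponent A g f}"

text \<open>\<open>D g = - 2 \<theta> \<otimes> g\<close>\<close>

definition weyl_form :: "('b::topological_space, 'f::euclidean_space) atlas \<Rightarrow> 'b conn \<Rightarrow> 'b form2 \<Rightarrow>
    'b form1 \<Rightarrow> bool" where
  "weyl_form A D g \<theta> \<longleftrightarrow> one_form A \<theta> \<and>
     (\<forall>U X Y Z. open U \<and> vector_field_on A U X \<and> vector_field_on A U Y \<and> vector_field_on A U Z \<longrightarrow>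
        (\<forall>p\<in>U. cov_deriv_metric D g X Y Z p = - 2 * \<theta> p (X p) * g p (Y p) (Z p)))"

text \<open>Uniqueness of the associated form is meant on tangent vectors only, since a form is a total
  function of functionals.\<close>

definition weyl_structure :: "('b::topological_space, 'f::euclidean_space) atlas \<Rightarrow> 'b form2 set \<Rightarrow>
    'b conn \<Rightarrow> bool" where
  "weyl_structure A c D \<longleftrightarrow> connection A D \<and> torsion_free A D \<and>
     (\<forall>g\<in>c. \<exists>\<theta>. weyl_form A D g \<theta> \<and>
        (\<forall>\<theta>'. weyl_form A D g \<theta>' \<longrightarrow> (\<forall>p. \<forall>v\<in>tangent_space A p. \<theta>' p v = \<theta> p v)))"

definition weyl_screen_structure :: "('b::topological_space, 'f::euclidean_space) atlas \<Rightarrow> 'b form2 \<Rightarrow>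
    ('b \<Rightarrow> 'b tangent set) \<Rightarrow> 'b conn \<Rightarrow> bool" where
  "weyl_screen_structure A g\<^sub>0 S D \<longleftrightarrow> weyl_structure A (conformal_class A g\<^sub>0) D \<and>
     (\<forall>U X Y. open U \<and> vector_field_on A U X \<and> vector_field_on A U Y \<longrightarrow>
        (\<forall>p\<in>U. D X (\<lambda>q. screen_proj A g\<^sub>0 S q (Y q)) p \<in> S p))"

definition weyl_closed :: "('b::topological_space, 'f::euclidean_space) atlas \<Rightarrow> 'b form2 set \<Rightarrow>
    'b conn \<Rightarrow> bool" where
  "weyl_closed A c D \<longleftrightarrow> (\<exists>g\<in>c. \<exists>\<theta>. weyl_form A D g \<theta> \<and> closed_form A \<theta>)"

text \<open>\<open>weyl_J_structure A g\<^sub>0 S \<xi> \<eta> \<theta>\<^sub>0 Dg\<^sub>0 D\<close>: \<open>D\<close> is given by the displayed formula for every metric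
  \<open>g\<close> of the class of \<open>g\<^sub>0\<close>, where \<open>Dg\<close> is a torsion-free \<open>g\<close>-compatible connection and, for
  \<open>g = g\<^sub>0\<close>, the given one \<open>Dg\<^sub>0\<close>. A torsion-free \<open>g\<close>-compatible connection is not unique when \<open>g\<close> is
  degenerate; two of them differ by a symmetric tensor with values in the radical, and the formula is
  only sensitive to the \<open>(\<xi>, \<xi>)\<close>-component of the latter. \<open>Q\<close> is the tensor called \<open>S\<close> in the formula
  (here \<open>S\<close> is the screen distribution).\<close>

definition weyl_J_structure :: "('b::topological_space, 'f::euclidean_space) atlas \<Rightarrow> 'b form2 \<Rightarrow>
    ('b \<Rightarrow> 'b tangent set) \<Rightarrow> 'b vfield \<Rightarrow> 'b form1 \<Rightarrow> 'b form1 \<Rightarrow> 'b conn \<Rightarrow> 'b conn \<Rightarrow> bool" where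
  "weyl_J_structure A g\<^sub>0 S \<xi> \<eta> \<theta>\<^sub>0 Dg\<^sub>0 D \<longleftrightarrow>
     (\<forall>f. conformal_exponent A g\<^sub>0 f \<longrightarrow>
        (let g = rescale f g\<^sub>0; \<theta> = (\<lambda>p v. \<theta>\<^sub>0 p v + v f) in
         \<exists>Dg Q. connection A Dg \<and> torsion_free A Dg \<and> metric_compatible A g Dg \<and>
           (f = (\<lambda>p. 0) \<longrightarrow> Dg = Dg\<^sub>0) \<and>
           sym_tensor A Q \<and> (\<forall>p. Q p (\<xi> p) (\<xi> p) = 0) \<and>
           (\<forall>U X Y. open U \<and> vector_field_on A U X \<and> section_on A S U Y \<longrightarrow>
              (\<forall>p\<in>U. Q p (X p) (Y p) =
                 screen_sff A g\<^sub>0 S \<xi> Dg X Y p + \<eta> p (X p) * \<theta> p (Y p))) \<and>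
           (\<forall>U X Y. open U \<and> vector_field_on A U X \<and> vector_field_on A U Y \<longrightarrow>
              (\<forall>p\<in>U. D X Y p = Dg X Y p + \<theta> p (X p) *\<^sub>R Y p + \<theta> p (Y p) *\<^sub>R X p
                 - g p (X p) (Y p) *\<^sub>R sharp A S g \<theta> p - Q p (X p) (Y p) *\<^sub>R \<xi> p))))"

end

theory Submission
  imports Defs
begin

text \<open>Since \<open>J\<close> is parallel and \<open>B = 0\<close>, the Gauss formula applied to \<open>V = - J \<xi>\<close> gives
  \<open>D\<^sub>X V = \<phi>(X) V\<close>, and because the induced connection is torsion-free and compatible with \<open>g\<^sub>0\<close>
  this yields \<open>d\<theta>\<^sub>0 = \<phi> \<and> \<theta>\<^sub>0\<close>. The form \<open>\<theta>\<^sub>0\<close> vanishes nowhere, as \<open>\<theta>\<^sub>0(J N) = - 1\<close>, so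
  \<open>d\<theta>\<^sub>0 = 0\<close> exactly when \<open>\<phi>\<close> is a multiple of \<open>\<theta>\<^sub>0\<close>, with the smooth factor \<open>\<phi>(X) / \<theta>\<^sub>0(X)\<close> near
  a point where \<open>\<theta>\<^sub>0(X) \<noteq> 0\<close>. All associated forms \<open>\<theta>\<^sub>0 + df\<close> have the same exterior derivative.

  To use the Gauss formula, tangent fields must be extended to the ambient manifold. In charts the
  immersion is a map \<open>F\<close> with injective derivative; if \<open>L\<close> is linear and \<open>L \<circ> F'(x\<^sub>0) = id\<close>, then
  \<open>\<rho> = (L \<circ> F)\<^sup>-\<^sup>1 \<circ> L\<close> is a smooth local left inverse of \<open>F\<close>, and pushing forward along \<open>F\<close> after
  composing with \<open>\<rho>\<close> extends the field.\<close>

section \<open>Calculus of smooth maps\<close>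

lemma Ck_on_cong:
  assumes "open U" "\<And>x. x \<in> U \<Longrightarrow> f x = g x" "Ck_on k U f"
  shows "Ck_on k U g"
  using assms(2,3)
proof (induction k arbitrary: f g)
  case 0
  then show ?case by (simp cong: continuous_on_cong_simp)
next
  case (Suc k)
  have d: "(g has_derivative frechet_derivative f (at x)) (at x)" if "x \<in> U" for x
  proof (rule has_derivative_transform_within_open)
    show "(f has_derivative frechet_derivative f (at x)) (at x)"
      using Suc.prems(2) that by (simp add: frechet_derivative_works[symmetric])
  qed (use assms(1) that Suc.prems(1) in auto)
  have e: "frechet_derivative f (at x) v = frechet_derivative g (at x) v" if "x \<in> U" for x v
    using frechet_derivative_at[OF d[OF that]] by simp
  have "Ck_on k U (\<lambda>x. frechet_derivative g (at x) v)" for v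
    by (rule Suc.IH[OF e]) (use Suc.prems(2) in auto)
  then show ?case using d by (auto simp: differentiable_def)
qed

text \<open>\<open>frechet_derivative\<close> is a choice operator, awkward to compute with.
  Uniqueness of derivatives allows any explicit candidate \<open>f'\<close> to be used in its place,
  which is how the closure properties below run their inductions.\<close>

lemma Ck_on_SucI:
  assumes "open U" "\<And>x. x \<in> U \<Longrightarrow> (f has_derivative f' x) (at x)"
    and "\<And>v. Ck_on k U (\<lambda>x. f' x v)"
  shows "Ck_on (Suc k) U f"
proof -
  have "f' x v = frechet_derivative f (at x) v" if "x \<in> U" for x v
    using frechet_derivative_at[OF assms(2)[OF that]] by simp
  then have "Ck_on k U (\<lambda>x. frechet_derivative f (at x) v)" for v
    by (rule Ck_on_cong[OF assms(1) _ assms(3)])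
  with assms(2) show ?thesis by (auto simp: differentiable_def)
qed

lemma Ck_on_SucD:
  assumes "Ck_on (Suc k) U f"
  shows "Ck_on k U f"
  using assms
proof (induction k arbitrary: f)
  case 0
  then show ?case
    by (auto intro!: continuous_at_imp_continuous_on differentiable_imp_continuous_within)
next
  case (Suc k)
  from Suc.prems have "\<forall>x\<in>U. f differentiable (at x)"
    and "\<And>v. Ck_on (Suc k) U (\<lambda>x. frechet_derivative f (at x) v)"
    by simp_all
  with Suc.IH show ?case by (auto simp del: Ck_on.simps(2) simp: Ck_on.simps(2)[of k U f])
qed

lemma Ck_on_subset: "Ck_on k U f \<Longrightarrow> V \<subseteq> U \<Longrightarrow> Ck_on k V f"
  by (induction k arbitrary: f) (auto intro: continuous_on_subset)

text \<open>\<open>Ck_on\<close> takes derivatives at points of the full space, so differentiability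
  needs no patching. Only the continuity at the bottom of the induction is collected from the
  neighbourhoods.\<close>

lemma Ck_on_local:
  assumes "\<And>x. x \<in> U \<Longrightarrow> \<exists>V. open V \<and> x \<in> V \<and> Ck_on k V f"
  shows "Ck_on k U f"
  using assms
proof (induction k arbitrary: f)
  case 0
  show ?case
  proof (simp, rule continuous_at_imp_continuous_on, rule ballI)
    fix x assume "x \<in> U"
    with 0 obtain V where "open V" "x \<in> V" "continuous_on V f" by force
    then show "isCont f x" by (simp add: continuous_on_eq_continuous_at)
  qed
next
  case (Suc k)
  have "Ck_on k U (\<lambda>x. frechet_derivative f (at x) v)" for v
    by (rule Suc.IH) (use Suc.prems in fastforce)
  with Suc.prems show ?case by fastforce
qed

lemma Ck_on_const: "open U \<Longrightarrow> Ck_on k U (\<lambda>x. c)"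
proof (induction k arbitrary: c)
  case (Suc k)
  show ?case by (rule Ck_on_SucI[OF Suc.prems has_derivative_const Suc.IH[OF Suc.prems]])
qed simp

lemma Ck_on_linear:
  assumes "bounded_linear L" "open U"
  shows "Ck_on k U L"
proof (cases k)
  case 0
  then show ?thesis using assms by (simp add: linear_continuous_on)
next
  case (Suc n)
  show ?thesis unfolding Suc
    by (rule Ck_on_SucI[OF assms(2) bounded_linear_imp_has_derivative[OF assms(1)] Ck_on_const[OF assms(2)]])
qed

lemma Ck_on_add:
  assumes "open U" "Ck_on k U f" "Ck_on k U g"
  shows "Ck_on k U (\<lambda>x. f x + g x)"
  using assms(2,3)
proof (induction k arbitrary: f g)
  case (Suc k)
  show ?case
  proof (rule Ck_on_SucI[OF assms(1)])
    fix x assume "x \<in> U"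
    with Suc.prems show "((\<lambda>x. f x + g x) has_derivative
        (\<lambda>v. frechet_derivative f (at x) v + frechet_derivative g (at x) v)) (at x)"
      by (auto intro!: has_derivative_add simp: frechet_derivative_works[symmetric])
  qed (use Suc in auto)
qed (auto intro: continuous_on_add)

text \<open>The product rule gives two terms, each pairing one function with a derivative of the
  other. The induction therefore varies \<open>f\<close> and \<open>g\<close> together. Products,
  scalar multiples and inner products are all instances.\<close>

lemma Ck_on_bilinear:
  assumes "bounded_bilinear b" "open U" "Ck_on k U f" "Ck_on k U g"
  shows "Ck_on k U (\<lambda>x. b (f x) (g x))"
  using assms(3,4)
proof (induction k arbitrary: f g)
  case 0
  then show ?case by (simp add: bounded_bilinear.continuous_on[OF assms(1)])
next
  case (Suc k)
  show ?case
  proof (rule Ck_on_SucI[OF assms(2)])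
    fix x assume "x \<in> U"
    with Suc.prems show "((\<lambda>x. b (f x) (g x)) has_derivative (\<lambda>v. b (f x) (frechet_derivative g (at x) v)
        + b (frechet_derivative f (at x) v) (g x))) (at x)"
      by (intro bounded_bilinear.FDERIV[OF assms(1)]) (auto simp: frechet_derivative_works[symmetric])
  next
    fix v
    show "Ck_on k U (\<lambda>x. b (f x) (frechet_derivative g (at x) v) + b (frechet_derivative f (at x) v) (g x))"
      by (intro Ck_on_add[OF assms(2)] Suc.IH) (use Suc.prems Ck_on_SucD in auto)
  qed
qed

lemma Ck_on_sum:
  assumes "open U" "\<And>i. i \<in> I \<Longrightarrow> Ck_on k U (f i)"
  shows "Ck_on k U (\<lambda>x. \<Sum>i\<in>I. f i x)"
  using assms(2)
  by (induction I rule: infinite_finite_induct) (auto intro!: Ck_on_add Ck_on_const assms(1))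

text \<open>\<open>Ck_on\<close> only controls derivatives in a fixed direction. Expanding in the
  basis reduces a direction that moves with the point to finitely many fixed ones with scalar
  coefficients.\<close>

lemma has_derivative_basis_expansion:
  fixes f :: "'a::euclidean_space \<Rightarrow> 'b::real_normed_vector"
  assumes "(f has_derivative f') F"
  shows "f' u = (\<Sum>i\<in>Basis. (u \<bullet> i) *\<^sub>R f' i)"
proof -
  interpret f': bounded_linear f' by (rule has_derivative_bounded_linear[OF assms])
  have "f' u = f' (\<Sum>i\<in>Basis. (u \<bullet> i) *\<^sub>R i)" by (simp add: euclidean_representation)
  also have "\<dots> = (\<Sum>i\<in>Basis. (u \<bullet> i) *\<^sub>R f' i)" by (simp only: f'.sum f'.scaleR)
  finally show ?thesis .
qed

text \<open>The chain rule evaluates the derivative of \<open>f\<close> in the moving direction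
  \<open>g'(x) v\<close>. After basis expansion it becomes a sum of scalar functions times partial
  derivatives of \<open>f\<close> composed with \<open>g\<close>, to which the induction hypothesis
  applies.\<close>

lemma Ck_on_compose:
  fixes f :: "'a::euclidean_space \<Rightarrow> 'b::real_normed_vector" and g :: "'c::real_normed_vector \<Rightarrow> 'a"
  assumes "open U" "open V" "g ` U \<subseteq> V" "Ck_on k V f" "Ck_on k U g"
  shows "Ck_on k U (\<lambda>x. f (g x))"
  using assms(4,5)
proof (induction k arbitrary: f)
  case 0
  then show ?case using assms(3) by (auto intro: continuous_on_compose2)
next
  case (Suc k)
  have f: "(f has_derivative frechet_derivative f (at (g x))) (at (g x))" if "x \<in> U" for x
    using Suc.prems(1) assms(3) that by (auto simp: frechet_derivative_works[symmetric])
  have g: "(g has_derivative frechet_derivative g (at x)) (at x)" if "x \<in> U" for x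
    using Suc.prems(2) that by (auto simp: frechet_derivative_works[symmetric])
  show ?case
  proof (rule Ck_on_SucI[OF assms(1)])
    fix x assume x: "x \<in> U"
    have "((\<lambda>x. f (g x)) has_derivative (\<lambda>v. frechet_derivative f (at (g x)) (frechet_derivative g (at x) v))) (at x)"
      by (rule has_derivative_compose[OF g[OF x] f[OF x]])
    then show "((\<lambda>x. f (g x)) has_derivative (\<lambda>v. \<Sum>i\<in>Basis. (frechet_derivative g (at x) v \<bullet> i) *\<^sub>R
        frechet_derivative f (at (g x)) i)) (at x)"
      by (simp only: has_derivative_basis_expansion[OF f[OF x], symmetric])
  next
    fix v
    have "Ck_on k U (\<lambda>x. frechet_derivative g (at x) v \<bullet> i)" for i
      by (intro Ck_on_bilinear[OF bounded_bilinear_inner] Ck_on_const assms(1)) (use Suc.prems in auto)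
    moreover have "Ck_on k U (\<lambda>x. frechet_derivative f (at (g x)) i)" for i
      by (rule Suc.IH) (use Suc.prems Ck_on_SucD in auto)
    ultimately show "Ck_on k U (\<lambda>x. \<Sum>i\<in>Basis. (frechet_derivative g (at x) v \<bullet> i) *\<^sub>R
        frechet_derivative f (at (g x)) i)"
      by (intro Ck_on_sum Ck_on_bilinear[OF bounded_bilinear_scaleR] assms(1))
  qed
qed

text \<open>The derivative of 1/f is a product of 1/f, f' and 1/f, so class C^k of 1/f together with
  class C^k of f' gives class C^(k+1) of 1/f.\<close>

lemma Ck_on_inverse:
  fixes f :: "'a::real_normed_vector \<Rightarrow> real"
  assumes "open U" "Ck_on k U f" "\<And>x. x \<in> U \<Longrightarrow> f x \<noteq> 0"
  shows "Ck_on k U (\<lambda>x. inverse (f x))"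
  using assms(2)
proof (induction k)
  case 0
  then show ?case using assms(3) by (auto intro: continuous_on_inverse)
next
  case (Suc k)
  then have inv: "Ck_on k U (\<lambda>x. inverse (f x))" using Ck_on_SucD by blast
  show ?case
  proof (rule Ck_on_SucI[OF assms(1)])
    fix x assume "x \<in> U"
    then show "((\<lambda>x. inverse (f x)) has_derivative
        (\<lambda>v. (- 1) * (inverse (f x) * (frechet_derivative f (at x) v * inverse (f x))))) (at x)"
      using Deriv.has_derivative_inverse[of f x "frechet_derivative f (at x)" UNIV] assms(3) Suc.prems
      by (simp add: frechet_derivative_works[symmetric] mult.assoc)
  next
    fix v show "Ck_on k U (\<lambda>x. (- 1) * (inverse (f x) * (frechet_derivative f (at x) v * inverse (f x))))"
      by (intro Ck_on_bilinear[OF bounded_bilinear_mult] assms(1) inv Ck_on_const) (use Suc.prems in auto)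
  qed
qed

section \<open>The same closure properties for smooth maps\<close>

lemma smooth_on_cong: "open U \<Longrightarrow> (\<And>x. x \<in> U \<Longrightarrow> f x = g x) \<Longrightarrow> smooth_on U f \<Longrightarrow> smooth_on U g"
  unfolding smooth_on_def by (meson Ck_on_cong)

lemma smooth_on_subset: "smooth_on U f \<Longrightarrow> V \<subseteq> U \<Longrightarrow> smooth_on V f"
  unfolding smooth_on_def by (meson Ck_on_subset)

lemma smooth_on_local:
  assumes "\<And>x. x \<in> U \<Longrightarrow> \<exists>V. open V \<and> x \<in> V \<and> smooth_on V f"
  shows "smooth_on U f"
  unfolding smooth_on_def
proof
  fix k show "Ck_on k U f"
    by (rule Ck_on_local) (use assms in \<open>force simp: smooth_on_def\<close>)
qed

lemma smooth_on_const: "open U \<Longrightarrow> smooth_on U (\<lambda>x. c)"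
  by (simp add: smooth_on_def Ck_on_const)

lemma smooth_on_linear: "bounded_linear L \<Longrightarrow> open U \<Longrightarrow> smooth_on U L"
  by (simp add: smooth_on_def Ck_on_linear)

lemma smooth_on_add: "open U \<Longrightarrow> smooth_on U f \<Longrightarrow> smooth_on U g \<Longrightarrow> smooth_on U (\<lambda>x. f x + g x)"
  by (simp add: smooth_on_def Ck_on_add)

lemma smooth_on_bilinear:
  "bounded_bilinear b \<Longrightarrow> open U \<Longrightarrow> smooth_on U f \<Longrightarrow> smooth_on U g \<Longrightarrow> smooth_on U (\<lambda>x. b (f x) (g x))"
  by (simp add: smooth_on_def Ck_on_bilinear)

lemmas smooth_on_scaleR = smooth_on_bilinear[OF bounded_bilinear_scaleR]
lemmas smooth_on_mult = smooth_on_bilinear[OF bounded_bilinear_mult]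

lemma smooth_on_inner: "open U \<Longrightarrow> smooth_on U f \<Longrightarrow> smooth_on U (\<lambda>x. f x \<bullet> i)"
  by (intro smooth_on_bilinear[OF bounded_bilinear_inner] smooth_on_const)

lemma smooth_on_sum:
  "open U \<Longrightarrow> (\<And>i. i \<in> I \<Longrightarrow> smooth_on U (f i)) \<Longrightarrow> smooth_on U (\<lambda>x. \<Sum>i\<in>I. f i x)"
  by (simp add: smooth_on_def Ck_on_sum)

lemma smooth_on_compose:
  fixes f :: "'a::euclidean_space \<Rightarrow> 'b::real_normed_vector" and g :: "'c::real_normed_vector \<Rightarrow> 'a"
  shows "open U \<Longrightarrow> open V \<Longrightarrow> g ` U \<subseteq> V \<Longrightarrow> smooth_on V f \<Longrightarrow> smooth_on U g \<Longrightarrow> smooth_on U (\<lambda>x. f (g x))"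
  unfolding smooth_on_def using Ck_on_compose by blast

lemma smooth_on_inverse:
  fixes f :: "'a::real_normed_vector \<Rightarrow> real"
  shows "open U \<Longrightarrow> smooth_on U f \<Longrightarrow> (\<And>x. x \<in> U \<Longrightarrow> f x \<noteq> 0) \<Longrightarrow> smooth_on U (\<lambda>x. inverse (f x))"
  by (simp add: smooth_on_def Ck_on_inverse)

lemma smooth_on_imp_has_derivative:
  assumes "smooth_on U f" "x \<in> U"
  shows "(f has_derivative frechet_derivative f (at x)) (at x)"
proof -
  have "Ck_on (Suc 0) U f" using assms unfolding smooth_on_def by blast
  then show ?thesis using assms(2) by (simp add: frechet_derivative_works[symmetric])
qed

lemma smooth_on_imp_continuous_on: "smooth_on U f \<Longrightarrow> continuous_on U f"
  unfolding smooth_on_def by (metis Ck_on.simps(1))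

lemma smooth_on_frechet_derivative: "smooth_on U f \<Longrightarrow> smooth_on U (\<lambda>x. frechet_derivative f (at x) v)"
  unfolding smooth_on_def using Ck_on.simps(2) by blast

text \<open>With \<open>u\<close> as the components of a vector field, this gives both smoothness of
  the field acting on a function and smoothness of its push-forward along a map.\<close>

lemma smooth_on_frechet_derivative_apply:
  fixes f :: "'a::euclidean_space \<Rightarrow> 'b::real_normed_vector"
  assumes "open U" "smooth_on U f" "smooth_on U u"
  shows "smooth_on U (\<lambda>x. frechet_derivative f (at x) (u x))"
proof (rule smooth_on_cong[OF assms(1)])
  show "smooth_on U (\<lambda>x. \<Sum>i\<in>Basis. (u x \<bullet> i) *\<^sub>R frechet_derivative f (at x) i)"
    by (intro smooth_on_sum smooth_on_scaleR smooth_on_inner smooth_on_frechet_derivative assms)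
  show "(\<Sum>i\<in>Basis. (u x \<bullet> i) *\<^sub>R frechet_derivative f (at x) i) = frechet_derivative f (at x) (u x)"
    if "x \<in> U" for x
    by (rule has_derivative_basis_expansion[OF smooth_on_imp_has_derivative[OF assms(2) that], symmetric])
qed

section \<open>The smooth inverse function theorem\<close>

lemma Ck_on_Pair:
  assumes "open U" "Ck_on k U f" "Ck_on k U g"
  shows "Ck_on k U (\<lambda>x. (f x, g x))"
  using assms(2,3)
proof (induction k arbitrary: f g)
  case (Suc k)
  show ?case
  proof (rule Ck_on_SucI[OF assms(1)])
    fix x assume "x \<in> U"
    with Suc.prems show "((\<lambda>x. (f x, g x)) has_derivative
        (\<lambda>v. (frechet_derivative f (at x) v, frechet_derivative g (at x) v))) (at x)"
      by (auto intro!: has_derivative_Pair simp: frechet_derivative_works[symmetric])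
  qed (use Suc in auto)
qed (auto intro: continuous_on_Pair)

lemma smooth_on_Pair:
  "open U \<Longrightarrow> smooth_on U f \<Longrightarrow> smooth_on U g \<Longrightarrow> smooth_on U (\<lambda>x. (f x, g x))"
  by (simp add: smooth_on_def Ck_on_Pair)

text \<open>This recasts the C^1 inverse function theorem. Its derivative must be continuous as a
  map into bounded linear operators; in finite dimension this can be checked on basis vectors. An
  injective endomorphism supplies the required left inverse.\<close>

lemma smooth_on_inverse_function:
  fixes f :: "'a::euclidean_space \<Rightarrow> 'a"
  assumes U: "open U" and f: "smooth_on U f" and x0: "x0 \<in> U" and inj: "inj (frechet_derivative f (at x0))"
  obtains U' V g where "open U'" "U' \<subseteq> U" "x0 \<in> U'" "open V" "homeomorphism U' V f g"
    "\<And>y. y \<in> V \<Longrightarrow> (g has_derivative inv (frechet_derivative f (at (g y)))) (at y)"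
    "\<And>y. y \<in> V \<Longrightarrow> bij (frechet_derivative f (at (g y)))"
proof -
  define f' where "f' = (\<lambda>x. Blinfun (frechet_derivative f (at x)))"
  have f'_apply: "blinfun_apply (f' x) = frechet_derivative f (at x)" if "x \<in> U" for x
    using has_derivative_bounded_linear[OF smooth_on_imp_has_derivative[OF f that]]
    by (simp add: f'_def bounded_linear_Blinfun_apply)
  have cont: "continuous_on U f'"
  proof (rule continuous_on_blinfun_componentwise)
    fix i :: 'a
    have "continuous_on U (\<lambda>x. frechet_derivative f (at x) i)"
      by (rule smooth_on_imp_continuous_on[OF smooth_on_frechet_derivative[OF f]])
    then show "continuous_on U (\<lambda>x. blinfun_apply (f' x) i)"
      by (simp add: f'_apply cong: continuous_on_cong)
  qed
  have "linear (frechet_derivative f (at x0))"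
    using has_derivative_linear[OF smooth_on_imp_has_derivative[OF f x0]] .
  then obtain L where L: "linear L" "L \<circ> frechet_derivative f (at x0) = id"
    using linear_injective_left_inverse inj by blast
  have inv: "Blinfun L o\<^sub>L f' x0 = id_blinfun"
    using L by (intro blinfun_eqI)
      (simp add: f'_apply[OF x0] bounded_linear_Blinfun_apply linear_conv_bounded_linear fun_eq_iff)
  have der: "(f has_derivative blinfun_apply (f' x)) (at x)" if "x \<in> U" for x
    using smooth_on_imp_has_derivative[OF f that] f'_apply[OF that] by simp
  obtain U' V g g' where *: "open U'" "U' \<subseteq> U" "x0 \<in> U'" "open V" "f x0 \<in> V" "homeomorphism U' V f g"
    "\<And>y. y \<in> V \<Longrightarrow> (g has_derivative (g' y)) (at y)"
    "\<And>y. y \<in> V \<Longrightarrow> g' y = inv (blinfun_apply (f'(g y)))"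
    "\<And>y. y \<in> V \<Longrightarrow> bij (blinfun_apply (f'(g y)))"
    using inverse_function_theorem[OF U der cont x0 inv] by blast
  have "g y \<in> U" if "y \<in> V" for y
    using *(2,6) that by (auto simp: homeomorphism_def)
  then show ?thesis
    using that[of U' V g] * f'_apply by metis
qed

text \<open>This is the formula d(A^-1) = - A^-1 (dA) A^-1 applied to v, expanded in the basis. The
  right-hand side involves only vectors \<open>inv (A x) c\<close> with fixed \<open>c\<close> and
  derivatives of \<open>A x b\<close> with fixed \<open>b\<close>, so it can feed an induction on
  the order of differentiability.\<close>

lemma inv_linear_family_has_derivative:
  fixes A :: "'a::euclidean_space \<Rightarrow> 'b::euclidean_space \<Rightarrow> 'b"
  assumes U: "open U" and lin: "\<And>x. x \<in> U \<Longrightarrow> linear (A x)" and bij: "\<And>x. x \<in> U \<Longrightarrow> bij (A x)"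
    and smooth: "\<And>u. smooth_on U (\<lambda>x. A x u)" and x: "x \<in> U"
  shows "((\<lambda>x. inv (A x) v) has_derivative (\<lambda>h. - (\<Sum>b\<in>Basis. (inv (A x) v \<bullet> b) *\<^sub>R (\<Sum>c\<in>Basis.
    (frechet_derivative (\<lambda>x. A x b) (at x) h \<bullet> c) *\<^sub>R inv (A x) c)))) (at x)"
proof -
  have inv_A: "A x (inv (A x) u) = u" "inv (A x) (A x u) = u" if "x \<in> U" for x u
    using bij[OF that] by (simp_all add: bij_is_inj bij_is_surj surj_f_inv_f)
  have rep: "A x u = (\<Sum>b\<in>Basis. (u \<bullet> b) *\<^sub>R A x b)" if "x \<in> U" for x u
    by (rule has_derivative_basis_expansion[OF linear_imp_has_derivative[OF lin[OF that]]])
  \<comment> \<open>The inverse function theorem for \<open>T\<close> makes \<open>(x, v) \<mapsto> inv (A x) v\<close> differentiable.\<close>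
  define T where "T = (\<lambda>p. (fst p, A (fst p) (snd p)))"
  let ?UU = "U \<times> (UNIV :: 'b set)"
  have oUU: "open ?UU" by (simp add: U open_Times)
  have "smooth_on ?UU T"
  proof (rule smooth_on_cong[OF oUU])
    show "smooth_on ?UU (\<lambda>p. (fst p, \<Sum>b\<in>Basis. (snd p \<bullet> b) *\<^sub>R A (fst p) b))"
      by (intro smooth_on_Pair oUU smooth_on_sum smooth_on_scaleR smooth_on_inner smooth_on_linear
          bounded_linear_fst bounded_linear_snd smooth_on_compose[OF oUU U _ smooth]) auto
  qed (auto simp: T_def rep[symmetric])
  define u where "u = inv (A x) v"
  \<comment> \<open>The derivative of \<open>T\<close> at \<open>(x, u)\<close> is block triangular:
    its first component is the projection \<open>fst\<close>, and on vectors \<open>(0, k)\<close>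
    its second component is \<open>A x k\<close>. Both diagonal blocks are injective.\<close>
  have injT: "inj (frechet_derivative T (at (x, u)))"
  proof -
    have T': "(T has_derivative frechet_derivative T (at (x, u))) (at (x, u))"
      by (rule smooth_on_imp_has_derivative[OF \<open>smooth_on ?UU T\<close>]) (simp add: x)
    have lT: "linear (frechet_derivative T (at (x, u)))" by (rule has_derivative_linear[OF T'])
    have 1: "fst (frechet_derivative T (at (x, u)) p) = fst p" for p
    proof -
      have "((\<lambda>p. fst (T p)) has_derivative (\<lambda>p. fst (frechet_derivative T (at (x, u)) p))) (at (x, u))"
        by (rule has_derivative_fst[OF T'])
      moreover have "((\<lambda>p. fst (T p)) has_derivative fst) (at (x, u))"
        unfolding T_def by (auto intro: derivative_eq_intros)
      ultimately have "(\<lambda>p. fst (frechet_derivative T (at (x, u)) p)) = fst"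
        by (rule has_derivative_unique)
      then show ?thesis by metis
    qed
    have 2: "snd (frechet_derivative T (at (x, u)) (0, k)) = A x k" for k
    proof -
      have "((\<lambda>z. (x, z)) has_derivative (\<lambda>k. (0, k))) (at u)"
        by (auto intro!: derivative_eq_intros)
      from has_derivative_compose[OF this T']
      have "((\<lambda>z. snd (T (x, z))) has_derivative (\<lambda>k. snd (frechet_derivative T (at (x, u)) (0, k)))) (at u)"
        by (rule has_derivative_snd)
      moreover have "((\<lambda>z. snd (T (x, z))) has_derivative A x) (at u)"
        unfolding T_def by (simp add: linear_imp_has_derivative lin[OF x])
      ultimately have "(\<lambda>k. snd (frechet_derivative T (at (x, u)) (0, k))) = A x"
        by (rule has_derivative_unique)
      then show ?thesis by metis
    qed
    show ?thesis
      unfolding linear_injective_0[OF lT]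
    proof (intro allI impI)
      fix p assume p: "frechet_derivative T (at (x, u)) p = 0"
      have "fst p = 0" using 1[of p] p by simp
      moreover from this have "A x (snd p) = 0" using 2[of "snd p"] p by (cases p) simp
      then have "snd p = 0" using inv_A(2)[OF x, of "snd p"] inv_A(2)[OF x, of 0] linear_0[OF lin[OF x]] by simp
      ultimately show "p = 0" by (simp add: prod_eq_iff)
    qed
  qed
  have xu: "(x, u) \<in> ?UU" using x by simp
  obtain U' V G where G: "open U'" "U' \<subseteq> ?UU" "(x, u) \<in> U'" "open V" "homeomorphism U' V T G"
    "\<And>y. y \<in> V \<Longrightarrow> (G has_derivative inv (frechet_derivative T (at (G y)))) (at y)"
    "\<And>y. y \<in> V \<Longrightarrow> bij (frechet_derivative T (at (G y)))"
    by (rule smooth_on_inverse_function[OF oUU \<open>smooth_on ?UU T\<close> xu injT], rule that)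
  have Txu: "T (x, u) = (x, v)" by (simp add: T_def u_def inv_A x)
  then have xv: "(x, v) \<in> V" using G(3,5) by (force simp: homeomorphism_def)
  have *: "snd (G (x', v)) = inv (A x') v" if "(x', v) \<in> V" for x'
  proof -
    have "T (G (x', v)) = (x', v)" "G (x', v) \<in> U'"
      using G(5) that by (auto simp: homeomorphism_def)
    then have "fst (G (x', v)) = x'" "A x' (snd (G (x', v))) = v" "x' \<in> U"
      using G(2) by (auto simp: T_def)
    then show ?thesis using inv_A(2) by metis
  qed
  let ?N = "(\<lambda>x. (x, v)) -` V"
  have N: "open ?N" by (intro open_vimage G continuous_intros)
  have "((\<lambda>x. (x, v)) has_derivative (\<lambda>h. (h, 0))) (at x)"
    by (auto intro!: derivative_eq_intros)
  from has_derivative_snd[OF has_derivative_compose[OF this G(6)[OF xv]]]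
  obtain w' where "((\<lambda>x. snd (G (x, v))) has_derivative w') (at x)" by blast
  then have w': "((\<lambda>x. inv (A x) v) has_derivative w') (at x)"
    by (rule has_derivative_transform_within_open[OF _ N]) (use xv * in auto)
  \<comment> \<open>So far \<open>w'\<close> is merely some derivative. Differentiating the constant
    function A_x (A_x^-1 v) = v by the product rule determines \<open>A x (w' h)\<close>, and
    applying the inverse of \<open>A x\<close> determines \<open>w'\<close>.\<close>
  let ?D = "\<lambda>b. frechet_derivative (\<lambda>x. A x b) (at x)"
  have "((\<lambda>x. \<Sum>b\<in>Basis. (inv (A x) v \<bullet> b) *\<^sub>R A x b) has_derivative
     (\<lambda>h. \<Sum>b\<in>Basis. (inv (A x) v \<bullet> b) *\<^sub>R ?D b h + (w' h \<bullet> b) *\<^sub>R A x b)) (at x)"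
    by (intro has_derivative_sum has_derivative_scaleR has_derivative_inner_left w'
        smooth_on_imp_has_derivative[OF smooth x])
  moreover have "((\<lambda>x. \<Sum>b\<in>Basis. (inv (A x) v \<bullet> b) *\<^sub>R A x b) has_derivative (\<lambda>h. 0)) (at x)"
    by (rule has_derivative_transform_within_open[OF has_derivative_const[of v] U x])
      (simp add: rep[symmetric] inv_A)
  ultimately have "(\<lambda>h. \<Sum>b\<in>Basis. (inv (A x) v \<bullet> b) *\<^sub>R ?D b h + (w' h \<bullet> b) *\<^sub>R A x b) = (\<lambda>h. 0)"
    by (rule has_derivative_unique)
  then have "(\<Sum>b\<in>Basis. (inv (A x) v \<bullet> b) *\<^sub>R ?D b h) + A x (w' h) = 0" for h
    unfolding rep[OF x, of "w' h"] by (simp add: sum.distrib fun_eq_iff)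
  then have Aw': "A x (w' h) = - (\<Sum>b\<in>Basis. (inv (A x) v \<bullet> b) *\<^sub>R ?D b h)" for h
    by (rule minus_unique[symmetric])
  have lin_inv: "linear (inv (A x))"
    by (rule linearI; rule injD[OF bij_is_inj[OF bij[OF x]]])
      (simp_all add: inv_A x linear_add[OF lin[OF x]] linear_cmul[OF lin[OF x]])
  have "w' h = - (\<Sum>b\<in>Basis. (inv (A x) v \<bullet> b) *\<^sub>R (\<Sum>c\<in>Basis. (?D b h \<bullet> c) *\<^sub>R inv (A x) c))" for h
  proof -
    have "w' h = inv (A x) (A x (w' h))" by (simp add: inv_A x)
    also have "\<dots> = - (\<Sum>b\<in>Basis. (inv (A x) v \<bullet> b) *\<^sub>R inv (A x) (?D b h))"
      unfolding Aw' by (simp add: linear_neg[OF lin_inv] linear_sum[OF lin_inv] linear_cmul[OF lin_inv])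
    finally show ?thesis
      unfolding has_derivative_basis_expansion[OF linear_imp_has_derivative[OF lin_inv], of "?D _ h"] .
  qed
  then have "w' = (\<lambda>h. - (\<Sum>b\<in>Basis. (inv (A x) v \<bullet> b) *\<^sub>R (\<Sum>c\<in>Basis. (?D b h \<bullet> c) *\<^sub>R inv (A x) c)))"
    by (rule ext)
  with w' show ?thesis by (simp only:)
qed

text \<open>By the preceding formula the derivative is a polynomial in functions of the same kind,
  for other vectors \<open>v\<close>, and in smooth data. Hence the induction on k is taken over all
  \<open>v\<close> at once.\<close>

lemma smooth_on_inv_linear_family:
  fixes A :: "'a::euclidean_space \<Rightarrow> 'b::euclidean_space \<Rightarrow> 'b"
  assumes U: "open U" and lin: "\<And>x. x \<in> U \<Longrightarrow> linear (A x)" and bij: "\<And>x. x \<in> U \<Longrightarrow> bij (A x)"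
    and smooth: "\<And>u. smooth_on U (\<lambda>x. A x u)"
  shows "smooth_on U (\<lambda>x. inv (A x) v)"
proof -
  note der = inv_linear_family_has_derivative[OF U lin bij smooth]
  have "Ck_on k U (\<lambda>x. inv (A x) v)" for k v
  proof (induction k arbitrary: v)
    case 0
    show ?case using has_derivative_continuous[OF der] by (auto intro: continuous_at_imp_continuous_on)
  next
    case (Suc k)
    have "Ck_on k U (\<lambda>x. frechet_derivative (\<lambda>x. A x b) (at x) h)" for b h
      using smooth_on_frechet_derivative[OF smooth] unfolding smooth_on_def by blast
    then have "Ck_on k U (\<lambda>x. (-1) *\<^sub>R (\<Sum>b\<in>Basis. (inv (A x) v \<bullet> b) *\<^sub>R (\<Sum>c\<in>Basis.
        (frechet_derivative (\<lambda>x. A x b) (at x) h \<bullet> c) *\<^sub>R inv (A x) c)))" for h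
      by (intro Ck_on_sum Ck_on_bilinear[OF bounded_bilinear_scaleR] Ck_on_bilinear[OF bounded_bilinear_inner]
          Ck_on_const Suc.IH U)
    then show ?case by (intro Ck_on_SucI[OF U der]) auto
  qed
  then show ?thesis by (simp add: smooth_on_def)
qed

text \<open>Bootstrapping: the derivative of \<open>g\<close> is the smooth map \<open>x\<close> to
  the inverse of f'(x), composed with \<open>g\<close>. If \<open>g\<close> is C^k then so is its
  derivative, and \<open>g\<close> is C^(k+1).\<close>

lemma smooth_on_smooth_local_inverse:
  fixes f :: "'a::euclidean_space \<Rightarrow> 'a"
  assumes U: "open U" and f: "smooth_on U f" and x0: "x0 \<in> U" and inj: "inj (frechet_derivative f (at x0))"
  obtains U' V g where "open U'" "U' \<subseteq> U" "x0 \<in> U'" "open V" "homeomorphism U' V f g" "smooth_on V g"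
proof -
  obtain U' V g where *: "open U'" "U' \<subseteq> U" "x0 \<in> U'" "open V" "homeomorphism U' V f g"
    and der: "\<And>y. y \<in> V \<Longrightarrow> (g has_derivative inv (frechet_derivative f (at (g y)))) (at y)"
    and bij: "\<And>y. y \<in> V \<Longrightarrow> bij (frechet_derivative f (at (g y)))"
    by (rule smooth_on_inverse_function[OF assms], rule that)
  have gV: "g ` V = U'" using *(5) by (simp add: homeomorphism_def)
  have W: "smooth_on U' (\<lambda>x. inv (frechet_derivative f (at x)) v)" for v
  proof (rule smooth_on_inv_linear_family[OF *(1)])
    fix x assume x: "x \<in> U'"
    show "linear (frechet_derivative f (at x))"
      using has_derivative_linear[OF smooth_on_imp_has_derivative[OF f]] x *(2) by blast
    show "bij (frechet_derivative f (at x))" using bij x gV by blast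
  qed (rule smooth_on_subset[OF smooth_on_frechet_derivative[OF f] *(2)])
  have "Ck_on k V g" for k
  proof (induction k)
    case 0
    show ?case using *(5) by (simp add: homeomorphism_def)
  next
    case (Suc k)
    show ?case
      by (rule Ck_on_SucI[OF *(4) der], assumption, rule Ck_on_compose[OF *(4,1) _ _ Suc])
        (use gV W in \<open>auto simp: smooth_on_def\<close>)
  qed
  then show ?thesis using that * by (simp add: smooth_on_def)
qed

text \<open>The inverse function theorem is applied to the equidimensional map
  \<open>L (F x)\<close>. The domain \<open>W\<close> is the full preimage under \<open>L\<close> of
  the neighbourhood where that map is inverted, so it is open and contains \<open>F x\<close> for
  every \<open>x\<close> in \<open>U'\<close>.\<close>

lemma smooth_on_local_left_inverse:
  fixes F :: "'a::euclidean_space \<Rightarrow> 'b::euclidean_space"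
  assumes U: "open U" and F: "smooth_on U F" and x0: "x0 \<in> U" and inj: "inj (frechet_derivative F (at x0))"
  obtains U' W \<rho> where "open U'" "x0 \<in> U'" "U' \<subseteq> U" "open W" "smooth_on W \<rho>" "\<rho> ` W \<subseteq> U'"
    "\<And>x. x \<in> U' \<Longrightarrow> F x \<in> W \<and> \<rho> (F x) = x"
proof -
  note F' = smooth_on_imp_has_derivative[OF F x0]
  obtain L where L: "linear L" "L \<circ> frechet_derivative F (at x0) = id"
    using linear_injective_left_inverse[OF has_derivative_linear[OF F'] inj] by blast
  have bl: "bounded_linear L" using L(1) by (simp add: linear_conv_bounded_linear)
  have h: "smooth_on U (\<lambda>x. L (F x))"
    by (rule smooth_on_compose[OF U open_UNIV _ smooth_on_linear[OF bl open_UNIV] F]) simp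
  have "((\<lambda>x. L (F x)) has_derivative (\<lambda>v. L (frechet_derivative F (at x0) v))) (at x0)"
    by (rule bounded_linear.has_derivative[OF bl F'])
  then have "((\<lambda>x. L (F x)) has_derivative id) (at x0)" using L(2) by (simp add: o_def)
  then have injh: "inj (frechet_derivative (\<lambda>x. L (F x)) (at x0))"
    by (metis frechet_derivative_at inj_on_id)
  obtain U' V g where *: "open U'" "U' \<subseteq> U" "x0 \<in> U'" "open V" "homeomorphism U' V (\<lambda>x. L (F x)) g" "smooth_on V g"
    by (rule smooth_on_smooth_local_inverse[OF U h x0 injh], rule that)
  have W: "open (L -` V)" using *(4) linear_continuous_on[OF bl] by (intro open_vimage) auto
  show ?thesis
  proof (rule that[OF *(1,3,2) W])
    show "smooth_on (L -` V) (\<lambda>y. g (L y))"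
      by (rule smooth_on_compose[OF W *(4) _ *(6) smooth_on_linear[OF bl W]]) auto
    show "(\<lambda>y. g (L y)) ` (L -` V) \<subseteq> U'" using *(5) by (auto simp: homeomorphism_def)
    show "F x \<in> L -` V \<and> g (L (F x)) = x" if "x \<in> U'" for x
      using *(5) that by (auto simp: homeomorphism_def)
  qed
qed

section \<open>Smooth functions, tangent vectors and vector fields\<close>

lemma smooth_atlas_chart:
  assumes "smooth_atlas A" "(U, \<phi>) \<in> A"
  shows "open U" "open (\<phi> ` U)" "homeomorphism U (\<phi> ` U) \<phi> (inv_into U \<phi>)"
  using assms unfolding smooth_atlas_def by auto

lemma smooth_atlas_inv_into:
  assumes "smooth_atlas A" "(U, \<phi>) \<in> A" "q \<in> U"
  shows "inv_into U \<phi> (\<phi> q) = q"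
  using smooth_atlas_chart(3)[OF assms(1,2)] assms(3) by (simp add: homeomorphism_def)

lemma smooth_atlas_covers:
  assumes "smooth_atlas A"
  obtains U \<phi> where "(U, \<phi>) \<in> A" "p \<in> U"
proof -
  have "p \<in> (\<Union>(U, \<phi>)\<in>A. U)" using assms by (simp add: smooth_atlas_def)
  then show ?thesis using that by auto
qed

lemma smooth_atlas_open_image:
  assumes "smooth_atlas A" "(U, \<phi>) \<in> A" "open W"
  shows "open (\<phi> ` (U \<inter> W))"
proof -
  have "openin (top_of_set (\<phi> ` U)) (\<phi> ` (U \<inter> W))"
    using homeomorphism_imp_open_map[OF smooth_atlas_chart(3)[OF assms(1,2)]] assms(3) by auto
  then show ?thesis using smooth_atlas_chart(2)[OF assms(1,2)] openin_open_eq by blast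
qed

text \<open>Transition maps become chart expressions of the identity, so statements about smooth
  maps also yield the change of charts.\<close>

lemma smooth_map_id: "smooth_atlas A \<Longrightarrow> smooth_map A A id"
  unfolding smooth_map_def smooth_atlas_def by auto

lemma smooth_map_chart_expression:
  assumes "smooth_map A A' \<iota>" "(U, \<phi>) \<in> A" "(W, \<psi>) \<in> A'"
  shows "smooth_on (\<phi> ` (U \<inter> \<iota> -` W)) (\<psi> \<circ> \<iota> \<circ> inv_into U \<phi>)"
  using assms unfolding smooth_map_def by auto

lemma smooth_map_open_vimage: "smooth_map A A' \<iota> \<Longrightarrow> open W \<Longrightarrow> open (\<iota> -` W)"
  unfolding smooth_map_def by (intro open_vimage) auto

lemma smooth_fun_chart:
  "smooth_fun A W f \<Longrightarrow> (U, \<phi>) \<in> A \<Longrightarrow> smooth_on (\<phi> ` (U \<inter> W)) (f \<circ> inv_into U \<phi>)"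
  unfolding smooth_fun_def by auto

lemma smooth_fun_subset: "smooth_fun A W f \<Longrightarrow> W' \<subseteq> W \<Longrightarrow> smooth_fun A W' f"
  unfolding smooth_fun_def by (fastforce elim!: smooth_on_subset)

lemma smooth_fun_local:
  assumes "smooth_atlas A" "\<And>p. p \<in> W \<Longrightarrow> \<exists>W'. open W' \<and> p \<in> W' \<and> smooth_fun A W' f"
  shows "smooth_fun A W f"
  unfolding smooth_fun_def
proof (intro ballI, clarify, rule smooth_on_local)
  fix U \<phi> y assume c: "(U, \<phi>) \<in> A" and "y \<in> \<phi> ` (U \<inter> W)"
  then obtain p where p: "p \<in> U" "p \<in> W" "y = \<phi> p" by auto
  then obtain W' where W': "open W'" "p \<in> W'" "smooth_fun A W' f" using assms(2) by blast
  then show "\<exists>V. open V \<and> y \<in> V \<and> smooth_on V (f \<circ> inv_into U \<phi>)"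
    using smooth_atlas_open_image[OF assms(1) c] smooth_fun_chart[OF _ c] p by blast
qed

lemma smooth_fun_cong:
  assumes "smooth_atlas A" "open W" "\<And>p. p \<in> W \<Longrightarrow> f p = g p" "smooth_fun A W f"
  shows "smooth_fun A W g"
  unfolding smooth_fun_def
proof (intro ballI, clarify)
  fix U \<phi> assume c: "(U, \<phi>) \<in> A"
  show "smooth_on (\<phi> ` (U \<inter> W)) (g \<circ> inv_into U \<phi>)"
    by (rule smooth_on_cong[OF smooth_atlas_open_image[OF assms(1) c assms(2)] _ smooth_fun_chart[OF assms(4) c]])
      (use smooth_atlas_inv_into[OF assms(1) c] assms(3) in auto)
qed

text \<open>In charts f o \<iota> is the composite of f o \<psi>^-1 and \<psi> o \<iota> o
  \<phi>^-1. A chart of the target covers only part of the set, which is why smoothness is proved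
  locally.\<close>

lemma smooth_fun_compose:
  assumes A: "smooth_atlas A" and A': "smooth_atlas A'" and \<iota>: "smooth_map A A' \<iota>"
    and W: "open W" and f: "smooth_fun A' W f"
  shows "smooth_fun A (\<iota> -` W) (f \<circ> \<iota>)"
  unfolding smooth_fun_def
proof (intro ballI, clarify, rule smooth_on_local)
  fix U \<phi> y assume c: "(U, \<phi>) \<in> A" and "y \<in> \<phi> ` (U \<inter> \<iota> -` W)"
  then obtain p where p: "p \<in> U" "\<iota> p \<in> W" "y = \<phi> p" by auto
  obtain W0 \<psi> where c': "(W0, \<psi>) \<in> A'" "\<iota> p \<in> W0" using smooth_atlas_covers[OF A'] by blast
  let ?V = "\<phi> ` (U \<inter> \<iota> -` (W0 \<inter> W))"
  have oV: "open ?V"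
    by (intro smooth_atlas_open_image[OF A c] smooth_map_open_vimage[OF \<iota>] open_Int W
        smooth_atlas_chart(1)[OF A' c'(1)])
  have "smooth_on ?V (\<lambda>y. (f \<circ> inv_into W0 \<psi>) ((\<psi> \<circ> \<iota> \<circ> inv_into U \<phi>) y))"
  proof (rule smooth_on_compose[OF oV smooth_atlas_open_image[OF A' c'(1) W]])
    show "(\<psi> \<circ> \<iota> \<circ> inv_into U \<phi>) ` ?V \<subseteq> \<psi> ` (W0 \<inter> W)"
      using smooth_atlas_inv_into[OF A c] by auto
    show "smooth_on ?V (\<psi> \<circ> \<iota> \<circ> inv_into U \<phi>)"
      by (rule smooth_on_subset[OF smooth_map_chart_expression[OF \<iota> c c'(1)]]) auto
  qed (rule smooth_fun_chart[OF f c'(1)])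
  then have "smooth_on ?V (f \<circ> \<iota> \<circ> inv_into U \<phi>)"
    by (rule smooth_on_cong[OF oV, rotated])
      (use smooth_atlas_inv_into[OF A c] smooth_atlas_inv_into[OF A' c'(1)] in auto)
  moreover have "y \<in> ?V" using p c'(2) by auto
  ultimately show "\<exists>V. open V \<and> y \<in> V \<and> smooth_on V (f \<circ> \<iota> \<circ> inv_into U \<phi>)"
    using oV by blast
qed

text \<open>\<open>smooth_fun\<close> quantifies over all charts; composing with the smooth
  transition maps reduces the check to one chart containing \<open>W\<close>.\<close>

lemma smooth_fun_single_chart:
  assumes A: "smooth_atlas A" and c: "(U, \<phi>) \<in> A" and W: "open W" "W \<subseteq> U"
    and f: "smooth_on (\<phi> ` W) (f \<circ> inv_into U \<phi>)"
  shows "smooth_fun A W f"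
  unfolding smooth_fun_def
proof (intro ballI, clarify)
  fix U' \<phi>' assume c': "(U', \<phi>') \<in> A"
  let ?V = "\<phi>' ` (U' \<inter> W)"
  have oV: "open ?V" by (rule smooth_atlas_open_image[OF A c' W(1)])
  have UW: "U \<inter> W = W" using W(2) by auto
  have "smooth_on ?V (\<lambda>y. (f \<circ> inv_into U \<phi>) ((\<phi> \<circ> id \<circ> inv_into U' \<phi>') y))"
  proof (rule smooth_on_compose[OF oV _ _ f])
    show "open (\<phi> ` W)" using smooth_atlas_open_image[OF A c W(1)] UW by simp
    show "(\<phi> \<circ> id \<circ> inv_into U' \<phi>') ` ?V \<subseteq> \<phi> ` W"
      using smooth_atlas_inv_into[OF A c'] by auto
    show "smooth_on ?V (\<phi> \<circ> id \<circ> inv_into U' \<phi>')"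
      by (rule smooth_on_subset[OF smooth_map_chart_expression[OF smooth_map_id[OF A] c' c]]) (use W(2) in auto)
  qed
  then show "smooth_on ?V (f \<circ> inv_into U' \<phi>')"
    by (rule smooth_on_cong[OF oV, rotated])
      (use smooth_atlas_inv_into[OF A c] smooth_atlas_inv_into[OF A c'] W(2) in auto)
qed

lemma smooth_fun_const: "smooth_atlas A \<Longrightarrow> open W \<Longrightarrow> smooth_fun A W (\<lambda>p. c)"
  unfolding smooth_fun_def by (auto simp: o_def intro!: smooth_on_const smooth_atlas_open_image)

lemma smooth_fun_add:
  "smooth_atlas A \<Longrightarrow> open W \<Longrightarrow> smooth_fun A W f \<Longrightarrow> smooth_fun A W g \<Longrightarrow> smooth_fun A W (\<lambda>p. f p + g p)"
  unfolding smooth_fun_def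
  by (auto simp: o_def intro!: smooth_on_add smooth_atlas_open_image)

lemma smooth_fun_mult:
  "smooth_atlas A \<Longrightarrow> open W \<Longrightarrow> smooth_fun A W f \<Longrightarrow> smooth_fun A W g \<Longrightarrow> smooth_fun A W (\<lambda>p. f p * g p)"
  unfolding smooth_fun_def
  by (auto simp: o_def intro!: smooth_on_mult smooth_atlas_open_image)

lemma smooth_fun_inverse:
  assumes "smooth_atlas A" "open W" "smooth_fun A W f" "\<And>p. p \<in> W \<Longrightarrow> f p \<noteq> 0"
  shows "smooth_fun A W (\<lambda>p. inverse (f p))"
  unfolding smooth_fun_def
proof (intro ballI, clarify)
  fix U \<phi> assume c: "(U, \<phi>) \<in> A"
  then show "smooth_on (\<phi> ` (U \<inter> W)) ((\<lambda>p. inverse (f p)) \<circ> inv_into U \<phi>)"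
    unfolding o_def
    by (intro smooth_on_inverse smooth_atlas_open_image[OF assms(1)] assms(2) smooth_fun_chart[OF assms(3), unfolded o_def])
      (use assms(4) smooth_atlas_inv_into[OF assms(1) c] in auto)
qed

text \<open>Continuity makes the set where a smooth function does not vanish open, so that quotients
  can be formed on it.\<close>

lemma smooth_fun_imp_continuous_on:
  assumes A: "smooth_atlas A" and W: "open W" and f: "smooth_fun A W f"
  shows "continuous_on W f"
proof (rule continuous_at_imp_continuous_on, rule ballI)
  fix p assume p: "p \<in> W"
  obtain U \<phi> where c: "(U, \<phi>) \<in> A" "p \<in> U" using smooth_atlas_covers[OF A] by blast
  have "continuous_on (U \<inter> W) (\<lambda>q. (f \<circ> inv_into U \<phi>) (\<phi> q))"
  proof (rule continuous_on_compose2[OF smooth_on_imp_continuous_on[OF smooth_fun_chart[OF f c(1)]]])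
    show "continuous_on (U \<inter> W) \<phi>"
      using smooth_atlas_chart(3)[OF A c(1)] by (auto simp: homeomorphism_def intro: continuous_on_subset)
  qed auto
  then have "continuous_on (U \<inter> W) f"
    by (rule continuous_on_eq) (simp add: smooth_atlas_inv_into[OF A c(1)])
  moreover have "open (U \<inter> W)" using smooth_atlas_chart(1)[OF A c(1)] W by blast
  ultimately show "isCont f p" using c(2) p by (simp add: continuous_on_eq_continuous_at)
qed

section \<open>Functions smooth near a point\<close>

lemma smooth_near_compose:
  assumes "smooth_atlas A" "smooth_atlas A'" "smooth_map A A' \<iota>" "smooth_near A' (\<iota> p) f"
  shows "smooth_near A p (f \<circ> \<iota>)"
  using assms(4) smooth_fun_compose[OF assms(1-3)] smooth_map_open_vimage[OF assms(3)]
  unfolding smooth_near_def by (metis vimage_eq)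

lemma smooth_near_add:
  assumes "smooth_atlas A" "smooth_near A p f" "smooth_near A p g"
  shows "smooth_near A p (\<lambda>q. f q + g q)"
proof -
  obtain W W' where "open W" "p \<in> W" "smooth_fun A W f" "open W'" "p \<in> W'" "smooth_fun A W' g"
    using assms(2,3) unfolding smooth_near_def by blast
  then show ?thesis unfolding smooth_near_def
    by (intro exI[of _ "W \<inter> W'"]) (auto intro!: smooth_fun_add assms(1) elim: smooth_fun_subset)
qed

lemma smooth_near_transform:
  assumes "smooth_atlas A" "open W" "p \<in> W" "\<And>q. q \<in> W \<Longrightarrow> f q = g q" "smooth_near A p f"
  shows "smooth_near A p g"
proof -
  obtain W' where W': "open W'" "p \<in> W'" "smooth_fun A W' f"
    using assms(5) unfolding smooth_near_def by blast
  have "smooth_fun A (W \<inter> W') g"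
    by (rule smooth_fun_cong[OF assms(1), of _ f]) (use assms W' in \<open>auto elim: smooth_fun_subset\<close>)
  then show ?thesis unfolding smooth_near_def using assms W' by blast
qed

lemma smooth_near_has_derivative:
  assumes "smooth_atlas A" "(U, \<phi>) \<in> A" "p \<in> U" "smooth_near A p f"
  shows "(f \<circ> inv_into U \<phi> has_derivative frechet_derivative (f \<circ> inv_into U \<phi>) (at (\<phi> p))) (at (\<phi> p))"
proof -
  obtain W where "open W" "p \<in> W" "smooth_fun A W f"
    using assms(4) unfolding smooth_near_def by blast
  then show ?thesis
    using smooth_on_imp_has_derivative[OF smooth_fun_chart[OF _ assms(2)]] assms(3) by blast
qed

section \<open>Tangent vectors in charts\<close>

lemma chart_vector_linear:
  assumes "smooth_atlas A" "(U, \<phi>) \<in> A" "p \<in> U"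
  shows "chart_vector A (U, \<phi>) p (a *\<^sub>R u + v) =
    a *\<^sub>R chart_vector A (U, \<phi>) p u + chart_vector A (U, \<phi>) p v"
proof
  fix f
  show "chart_vector A (U, \<phi>) p (a *\<^sub>R u + v) f =
    (a *\<^sub>R chart_vector A (U, \<phi>) p u + chart_vector A (U, \<phi>) p v) f"
  proof (cases "smooth_near A p f")
    case True
    have "linear (frechet_derivative (f \<circ> inv_into U \<phi>) (at (\<phi> p)))"
      by (rule has_derivative_linear[OF smooth_near_has_derivative[OF assms True]])
    then show ?thesis by (simp add: chart_vector_def scaleR_fun_def linear_add linear_cmul)
  qed (simp add: chart_vector_def scaleR_fun_def)
qed

lemma smooth_fun_chart_coordinate:
  assumes A: "smooth_atlas A" and c: "(U, \<phi>) \<in> A" and W: "open W" "W \<subseteq> U"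
  shows "smooth_fun A W (\<lambda>q. \<phi> q \<bullet> b)"
proof (rule smooth_fun_single_chart[OF A c W])
  have "U \<inter> W = W" using W(2) by auto
  then have o: "open (\<phi> ` W)" using smooth_atlas_open_image[OF A c W(1)] by simp
  show "smooth_on (\<phi> ` W) ((\<lambda>q. \<phi> q \<bullet> b) \<circ> inv_into U \<phi>)"
    by (rule smooth_on_cong[OF o _ smooth_on_inner[OF o smooth_on_linear[OF bounded_linear_ident o]]])
      (use smooth_atlas_inv_into[OF A c] W(2) in auto)
qed

text \<open>Coordinate functions serve as test functions: they read off the components of a tangent
  vector, so a chart parametrises tangent vectors injectively and components of fields can be
  recovered.\<close>

lemma chart_vector_coordinate:
  assumes A: "smooth_atlas A" and c: "(U, \<phi>) \<in> A" and p: "p \<in> U"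
  shows "chart_vector A (U, \<phi>) p u (\<lambda>q. \<phi> q \<bullet> b) = u \<bullet> b"
proof -
  have U: "open U" by (rule smooth_atlas_chart(1)[OF A c])
  have sn: "smooth_near A p (\<lambda>q. \<phi> q \<bullet> b)"
    unfolding smooth_near_def using smooth_fun_chart_coordinate[OF A c U] U p by blast
  have "(((\<lambda>q. \<phi> q \<bullet> b) \<circ> inv_into U \<phi>) has_derivative (\<lambda>v. v \<bullet> b)) (at (\<phi> p))"
    by (rule has_derivative_transform_within_open[OF _ smooth_atlas_chart(2)[OF A c], of "\<lambda>y. y \<bullet> b"])
      (use p smooth_atlas_inv_into[OF A c] in \<open>auto intro!: derivative_eq_intros\<close>)
  then show ?thesis using sn by (simp add: chart_vector_def frechet_derivative_at[symmetric])
qed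

lemma chart_vector_inject:
  assumes "smooth_atlas A" "(U, \<phi>) \<in> A" "p \<in> U" "chart_vector A (U, \<phi>) p u = chart_vector A (U, \<phi>) p v"
  shows "u = v"
  by (rule euclidean_eqI) (metis assms(4) chart_vector_coordinate[OF assms(1-3)])

text \<open>This is the chain rule on functions smooth near the image point. There
  \<open>f o \<iota>\<close> is smooth near \<open>p\<close>, so the inner chart vector does not
  fall back to its default. On all other functions both sides are the default value 0.\<close>

lemma tangent_map_chart_vector:
  assumes A: "smooth_atlas A" and A': "smooth_atlas A'" and \<iota>: "smooth_map A A' \<iota>"
    and c: "(U, \<phi>) \<in> A" "p \<in> U" and c': "(W, \<psi>) \<in> A'" "\<iota> p \<in> W"
  shows "tangent_map A' \<iota> p (chart_vector A (U, \<phi>) p u) =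
    chart_vector A' (W, \<psi>) (\<iota> p) (frechet_derivative (\<psi> \<circ> \<iota> \<circ> inv_into U \<phi>) (at (\<phi> p)) u)"
proof
  fix f
  show "tangent_map A' \<iota> p (chart_vector A (U, \<phi>) p u) f =
    chart_vector A' (W, \<psi>) (\<iota> p) (frechet_derivative (\<psi> \<circ> \<iota> \<circ> inv_into U \<phi>) (at (\<phi> p)) u) f"
  proof (cases "smooth_near A' (\<iota> p) f")
    case True
    let ?F = "\<psi> \<circ> \<iota> \<circ> inv_into U \<phi>"
    have ip: "inv_into U \<phi> (\<phi> p) = p" by (rule smooth_atlas_inv_into[OF A c])
    have V: "open (\<phi> ` (U \<inter> \<iota> -` W))"
      by (intro smooth_atlas_open_image[OF A c(1)] smooth_map_open_vimage[OF \<iota>] smooth_atlas_chart(1)[OF A' c'(1)])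
    have "(?F has_derivative frechet_derivative ?F (at (\<phi> p))) (at (\<phi> p))"
      by (rule smooth_on_imp_has_derivative[OF smooth_map_chart_expression[OF \<iota> c(1) c'(1)]]) (use c(2) c'(2) in auto)
    moreover have "(f \<circ> inv_into W \<psi> has_derivative frechet_derivative (f \<circ> inv_into W \<psi>) (at (\<psi> (\<iota> p)))) (at (?F (\<phi> p)))"
      using smooth_near_has_derivative[OF A' c' True] by (simp add: ip)
    ultimately have "((\<lambda>y. (f \<circ> inv_into W \<psi>) (?F y)) has_derivative
        (\<lambda>v. frechet_derivative (f \<circ> inv_into W \<psi>) (at (\<psi> (\<iota> p))) (frechet_derivative ?F (at (\<phi> p)) v))) (at (\<phi> p))"
      by (rule has_derivative_compose)
    then have "(f \<circ> \<iota> \<circ> inv_into U \<phi> has_derivative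
        (\<lambda>v. frechet_derivative (f \<circ> inv_into W \<psi>) (at (\<psi> (\<iota> p))) (frechet_derivative ?F (at (\<phi> p)) v))) (at (\<phi> p))"
      by (rule has_derivative_transform_within_open[OF _ V])
        (use c(2) c'(2) smooth_atlas_inv_into[OF A c(1)] smooth_atlas_inv_into[OF A' c'(1)] in auto)
    from fun_cong[OF frechet_derivative_at[OF this], of u] show ?thesis
      using True smooth_near_compose[OF A A' \<iota> True] by (simp add: tangent_map_def chart_vector_def)
  qed (simp add: tangent_map_def chart_vector_def)
qed

lemma tangent_map_id_chart_vector: "tangent_map A id p (chart_vector A c p u) = chart_vector A c p u"
  by (simp add: tangent_map_def chart_vector_def fun_eq_iff)

text \<open>The chain rule for \<iota> = id is the change of charts, so each chart around
  \<open>p\<close> already gives every tangent vector.\<close>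

lemma tangent_space_chart:
  assumes A: "smooth_atlas A" and c: "(U, \<phi>) \<in> A" "p \<in> U"
  shows "tangent_space A p = range (chart_vector A (U, \<phi>) p)"
proof
  show "tangent_space A p \<subseteq> range (chart_vector A (U, \<phi>) p)"
  proof
    fix v assume "v \<in> tangent_space A p"
    then obtain U' \<phi>' u where "(U', \<phi>') \<in> A" "p \<in> U'" "v = chart_vector A (U', \<phi>') p u"
      unfolding tangent_space_def by auto
    then show "v \<in> range (chart_vector A (U, \<phi>) p)"
      using tangent_map_chart_vector[OF A A smooth_map_id[OF A], of U' \<phi>' p U \<phi> u] c
      by (auto simp: tangent_map_id_chart_vector)
  qed
  show "range (chart_vector A (U, \<phi>) p) \<subseteq> tangent_space A p"
    unfolding tangent_space_def using c by force
qed

lemma tangent_space_obtain_chart: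
  assumes "smooth_atlas A" "v \<in> tangent_space A p"
  obtains U \<phi> u where "(U, \<phi>) \<in> A" "p \<in> U" "v = chart_vector A (U, \<phi>) p u"
  using assms(2) unfolding tangent_space_def by auto

lemma subspace_tangent_space:
  assumes A: "smooth_atlas A"
  shows "subspace (tangent_space A p)"
proof -
  obtain U \<phi> where c: "(U, \<phi>) \<in> A" "p \<in> U" using smooth_atlas_covers[OF A] by blast
  note lin = chart_vector_linear[OF A c] and T = tangent_space_chart[OF A c]
  have *: "a *\<^sub>R x + y \<in> tangent_space A p" if "x \<in> tangent_space A p" "y \<in> tangent_space A p" for a x y
    using that unfolding T by (auto simp: lin[symmetric])
  \<comment> \<open>With coefficient -1 and both directions 0, linearity exhibits the zero
    functional as the chart vector of the direction 0.\<close>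
  have 0: "0 \<in> tangent_space A p"
    using lin[of "-1" 0 0] unfolding T by (metis add.left_inverse rangeI scaleR_minus1_left)
  show ?thesis
    unfolding subspace_def using * 0 by (metis add.right_neutral scaleR_one)
qed

lemma tangent_map_tangent_space:
  assumes A: "smooth_atlas A" and A': "smooth_atlas A'" and \<iota>: "smooth_map A A' \<iota>" and v: "v \<in> tangent_space A p"
  shows "tangent_map A' \<iota> p v \<in> tangent_space A' (\<iota> p)"
proof -
  obtain U \<phi> u where c: "(U, \<phi>) \<in> A" "p \<in> U" "v = chart_vector A (U, \<phi>) p u"
    by (rule tangent_space_obtain_chart[OF A v])
  obtain W \<psi> where c': "(W, \<psi>) \<in> A'" "\<iota> p \<in> W" using smooth_atlas_covers[OF A'] by blast
  show ?thesis
    unfolding c(3) tangent_map_chart_vector[OF A A' \<iota> c(1,2) c'] tangent_space_chart[OF A' c'] by blast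
qed

lemma tangent_map_linear:
  "tangent_map A' \<iota> p (a *\<^sub>R u + v) = a *\<^sub>R tangent_map A' \<iota> p u + tangent_map A' \<iota> p v"
  by (simp add: tangent_map_def scaleR_fun_def fun_eq_iff)

text \<open>Fields and forms are total functions that are meaningful only on an open set or on
  tangent vectors, so locality is needed to replace one by another under a derivative. Smoothness
  near \<open>p\<close> must transfer as well, for the default values to agree.\<close>

lemma tangent_vector_local:
  assumes A: "smooth_atlas A" and v: "v \<in> tangent_space A p" and W: "open W" "p \<in> W"
    and eq: "\<And>q. q \<in> W \<Longrightarrow> f q = g q"
  shows "v f = v g"
proof -
  obtain U \<phi> u where c: "(U, \<phi>) \<in> A" "p \<in> U" "v = chart_vector A (U, \<phi>) p u"
    by (rule tangent_space_obtain_chart[OF A v])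
  have iff: "smooth_near A p f \<longleftrightarrow> smooth_near A p g"
    using smooth_near_transform[OF A W, of f g] smooth_near_transform[OF A W, of g f] eq by auto
  show ?thesis
  proof (cases "smooth_near A p f")
    case True
    have "(g \<circ> inv_into U \<phi> has_derivative frechet_derivative (f \<circ> inv_into U \<phi>) (at (\<phi> p))) (at (\<phi> p))"
      by (rule has_derivative_transform_within_open[OF smooth_near_has_derivative[OF A c(1,2) True]
            smooth_atlas_open_image[OF A c(1) W(1)]])
        (use c(2) W(2) eq smooth_atlas_inv_into[OF A c(1)] in auto)
    from frechet_derivative_at[OF this] show ?thesis using True iff by (simp add: c(3) chart_vector_def)
  qed (use iff c(3) in \<open>simp add: chart_vector_def\<close>)
qed

lemma tangent_vector_const:
  assumes A: "smooth_atlas A" and v: "v \<in> tangent_space A p"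
  shows "v (\<lambda>q. a) = 0"
proof -
  obtain U \<phi> u where c: "(U, \<phi>) \<in> A" "p \<in> U" "v = chart_vector A (U, \<phi>) p u"
    by (rule tangent_space_obtain_chart[OF A v])
  then show ?thesis by (simp add: chart_vector_def o_def frechet_derivative_const)
qed

text \<open>Smoothness of both summands is essential: if neither is smooth but the sum is, the
  default 0 on the summands may break additivity.\<close>

lemma tangent_vector_add:
  assumes A: "smooth_atlas A" and v: "v \<in> tangent_space A p"
    and f: "smooth_near A p f" and g: "smooth_near A p g"
  shows "v (\<lambda>q. f q + g q) = v f + v g"
proof -
  obtain U \<phi> u where c: "(U, \<phi>) \<in> A" "p \<in> U" "v = chart_vector A (U, \<phi>) p u"
    by (rule tangent_space_obtain_chart[OF A v])
  note fg = smooth_near_has_derivative[OF A c(1,2) f] smooth_near_has_derivative[OF A c(1,2) g]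
  from frechet_derivative_at[OF has_derivative_add[OF fg]] show ?thesis
    using f g smooth_near_add[OF A f g] unfolding c(3) chart_vector_def
    by (simp add: o_def fun_eq_iff)
qed

section \<open>Vector fields and their extension along an immersion\<close>

lemma vector_field_onD:
  assumes "vector_field_on A U X"
  shows "p \<in> U \<Longrightarrow> X p \<in> tangent_space A p"
    and "open W \<Longrightarrow> W \<subseteq> U \<Longrightarrow> smooth_fun A W f \<Longrightarrow> smooth_fun A W (\<lambda>p. X p f)"
  using assms unfolding vector_field_on_def by (fast, fast)

lemma vector_field_on_subset: "vector_field_on A U X \<Longrightarrow> W \<subseteq> U \<Longrightarrow> vector_field_on A W X"
  using vector_field_onD[of A U X] unfolding vector_field_on_def[of A W X]
  by (metis subset_eq subset_trans)

lemma vector_field_on_smooth_near: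
  assumes "vector_field_on A U X" "open U" "p \<in> U" "smooth_near A p f"
  shows "smooth_near A p (\<lambda>q. X q f)"
proof -
  obtain W where W: "open W" "p \<in> W" "smooth_fun A W f" using assms(4) unfolding smooth_near_def by blast
  then have "smooth_fun A (U \<inter> W) (\<lambda>q. X q f)"
    using assms(2) W(1) smooth_fun_subset[OF W(3), of "U \<inter> W"]
    by (intro vector_field_onD(2)[OF assms(1)]) auto
  then show ?thesis unfolding smooth_near_def using W assms by blast
qed

lemma vector_field_on_linear:
  assumes A: "smooth_atlas A" and U: "open U" and f: "smooth_fun A U f"
    and X: "vector_field_on A U X" and Y: "vector_field_on A U Y"
  shows "vector_field_on A U (\<lambda>q. f q *\<^sub>R X q + Y q)"
  unfolding vector_field_on_def
proof (intro conjI ballI allI impI)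
  fix p assume "p \<in> U"
  then show "f p *\<^sub>R X p + Y p \<in> tangent_space A p"
    using vector_field_onD(1)[OF X] vector_field_onD(1)[OF Y] subspace_tangent_space[OF A]
    by (simp add: subspace_add subspace_scale)
next
  fix W h assume W: "open W \<and> W \<subseteq> U \<and> smooth_fun A W h"
  then have "smooth_fun A W (\<lambda>p. X p h)" "smooth_fun A W (\<lambda>p. Y p h)"
    using vector_field_onD(2)[OF X] vector_field_onD(2)[OF Y] by auto
  then show "smooth_fun A W (\<lambda>p. (f p *\<^sub>R X p + Y p) h)"
    using W smooth_fun_subset[OF f] by (auto simp: scaleR_fun_def intro!: smooth_fun_add smooth_fun_mult A)
qed

lemma vector_field_on_chart_vector:
  assumes A: "smooth_atlas A" and c: "(U, \<phi>) \<in> A" and W: "open W" "W \<subseteq> U" and u: "smooth_on (\<phi> ` W) u"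
  shows "vector_field_on A W (\<lambda>q. chart_vector A (U, \<phi>) q (u (\<phi> q)))"
  unfolding vector_field_on_def
proof (intro conjI ballI allI impI)
  fix p assume "p \<in> W"
  then show "chart_vector A (U, \<phi>) p (u (\<phi> p)) \<in> tangent_space A p"
    using tangent_space_chart[OF A c] W(2) by auto
next
  fix W' f assume W': "open W' \<and> W' \<subseteq> W \<and> smooth_fun A W' f"
  then have "U \<inter> W' = W'" using W(2) by auto
  with smooth_atlas_open_image[OF A c, of W'] smooth_fun_chart[of A W' f, OF _ c] W'
  have o: "open (\<phi> ` W')" and f: "smooth_on (\<phi> ` W') (f \<circ> inv_into U \<phi>)" by auto
  have "smooth_on (\<phi> ` W') (\<lambda>y. frechet_derivative (f \<circ> inv_into U \<phi>) (at y) (u y))"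
    by (rule smooth_on_frechet_derivative_apply[OF o f smooth_on_subset[OF u]]) (use W' in auto)
  then have "smooth_on (\<phi> ` W') ((\<lambda>q. chart_vector A (U, \<phi>) q (u (\<phi> q)) f) \<circ> inv_into U \<phi>)"
  proof (rule smooth_on_cong[OF o, rotated])
    fix y assume "y \<in> \<phi> ` W'"
    then obtain q where q: "q \<in> W'" "y = \<phi> q" by auto
    then have "smooth_near A q f" unfolding smooth_near_def using W' by blast
    then show "frechet_derivative (f \<circ> inv_into U \<phi>) (at y) (u y) =
        ((\<lambda>q. chart_vector A (U, \<phi>) q (u (\<phi> q)) f) \<circ> inv_into U \<phi>) y"
      using q W' W(2) smooth_atlas_inv_into[OF A c, of q] by (auto simp: chart_vector_def)
  qed
  then show "smooth_fun A W' (\<lambda>q. chart_vector A (U, \<phi>) q (u (\<phi> q)) f)"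
    by (rule smooth_fun_single_chart[OF A c, rotated 2]) (use W' W(2) in auto)
qed

text \<open>Applying the field to the coordinate functions gives its components, which are smooth
  because the field maps smooth functions to smooth functions.\<close>

lemma vector_field_on_chart_coordinates:
  assumes A: "smooth_atlas A" and c: "(U, \<phi>) \<in> A" and W: "open W" and X: "vector_field_on A W X"
  obtains u where "smooth_on (\<phi> ` (U \<inter> W)) u" "\<And>q. q \<in> U \<inter> W \<Longrightarrow> X q = chart_vector A (U, \<phi>) q (u (\<phi> q))"
proof
  define u where "u = (\<lambda>y. \<Sum>b\<in>Basis. X (inv_into U \<phi> y) (\<lambda>q. \<phi> q \<bullet> b) *\<^sub>R b)"
  have oU: "open (U \<inter> W)" using smooth_atlas_chart(1)[OF A c] W by blast
  have o: "open (\<phi> ` (U \<inter> W))" by (rule smooth_atlas_open_image[OF A c W])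
  have "smooth_fun A (U \<inter> W) (\<lambda>p. X p (\<lambda>q. \<phi> q \<bullet> b))" for b
    using smooth_fun_chart_coordinate[OF A c oU, of b] oU by (intro vector_field_onD(2)[OF X]) auto
  from smooth_fun_chart[OF this c]
  have "smooth_on (\<phi> ` (U \<inter> W)) (\<lambda>y. X (inv_into U \<phi> y) (\<lambda>q. \<phi> q \<bullet> b))" for b
    by (simp add: o_def Int_absorb1)
  then show "smooth_on (\<phi> ` (U \<inter> W)) u"
    unfolding u_def by (intro smooth_on_sum smooth_on_scaleR smooth_on_const o)
  fix q assume q: "q \<in> U \<inter> W"
  then obtain w where w: "X q = chart_vector A (U, \<phi>) q w"
    using vector_field_onD(1)[OF X, of q] tangent_space_chart[OF A c, of q] by auto
  have "u (\<phi> q) = w"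
    using q smooth_atlas_inv_into[OF A c, of q]
    by (simp add: u_def w chart_vector_coordinate[OF A c] euclidean_representation)
  with w show "X q = chart_vector A (U, \<phi>) q (u (\<phi> q))" by simp
qed

text \<open>In a chart the vector is extended with constant components.\<close>

lemma tangent_vector_extend:
  assumes A: "smooth_atlas A" and v: "v \<in> tangent_space A p"
  obtains U X where "open U" "p \<in> U" "vector_field_on A U X" "X p = v"
proof -
  obtain U \<phi> u where c: "(U, \<phi>) \<in> A" "p \<in> U" "v = chart_vector A (U, \<phi>) p u"
    by (rule tangent_space_obtain_chart[OF A v])
  show ?thesis
    by (rule that[OF smooth_atlas_chart(1)[OF A c(1)] c(2) vector_field_on_chart_vector[OF A c(1)
            smooth_atlas_chart(1)[OF A c(1)] subset_refl smooth_on_const[OF smooth_atlas_chart(2)[OF A c(1)]]] c(3)[symmetric]])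
qed

text \<open>\<open>W\<close> is obtained before \<open>X\<close> is chosen, so that several fields
  can be extended over the same neighbourhood, as the Gauss formula requires.\<close>

lemma immersion_extend_vector_field:
  assumes A: "smooth_atlas A" and A': "smooth_atlas A'" and imm: "immersion A A' \<iota>"
    and U: "open U" "p \<in> U"
  obtains W where "open W" "\<iota> p \<in> W"
    "\<And>X. vector_field_on A U X \<Longrightarrow> \<exists>X'. vector_field_on A' W X' \<and> related_near A' \<iota> p X X'"
proof -
  have \<iota>: "smooth_map A A' \<iota>" using imm unfolding immersion_def by blast
  obtain U0 \<phi> where c: "(U0, \<phi>) \<in> A" "p \<in> U0" using smooth_atlas_covers[OF A] by blast
  obtain W0 \<psi> where c': "(W0, \<psi>) \<in> A'" "\<iota> p \<in> W0" using smooth_atlas_covers[OF A'] by blast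
  define F where "F = \<psi> \<circ> \<iota> \<circ> inv_into U0 \<phi>"
  define \<Omega> where "\<Omega> = \<phi> ` (U0 \<inter> (\<iota> -` W0 \<inter> U))"
  have o\<Omega>: "open \<Omega>" unfolding \<Omega>_def
    by (intro smooth_atlas_open_image[OF A c(1)] open_Int U smooth_map_open_vimage[OF \<iota>] smooth_atlas_chart(1)[OF A' c'(1)])
  have F: "smooth_on \<Omega> F"
    unfolding F_def by (rule smooth_on_subset[OF smooth_map_chart_expression[OF \<iota> c(1) c'(1)]]) (auto simp: \<Omega>_def)
  have p\<Omega>: "\<phi> p \<in> \<Omega>" using c c' U by (auto simp: \<Omega>_def)
  have dF: "tangent_map A' \<iota> q (chart_vector A (U0, \<phi>) q u) =
      chart_vector A' (W0, \<psi>) (\<iota> q) (frechet_derivative F (at (\<phi> q)) u)" if "q \<in> U0" "\<iota> q \<in> W0" for q u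
    unfolding F_def by (rule tangent_map_chart_vector[OF A A' \<iota> c(1) that(1) c'(1) that(2)])
  have inj: "inj (frechet_derivative F (at (\<phi> p)))"
  proof (rule injI)
    fix u v assume "frechet_derivative F (at (\<phi> p)) u = frechet_derivative F (at (\<phi> p)) v"
    then have "tangent_map A' \<iota> p (chart_vector A (U0, \<phi>) p u) = tangent_map A' \<iota> p (chart_vector A (U0, \<phi>) p v)"
      by (simp add: dF c c')
    moreover have "inj_on (tangent_map A' \<iota> p) (tangent_space A p)" using imm unfolding immersion_def by blast
    ultimately have "chart_vector A (U0, \<phi>) p u = chart_vector A (U0, \<phi>) p v"
      using tangent_space_chart[OF A c] by (auto dest: inj_onD)
    then show "u = v" by (rule chart_vector_inject[OF A c])
  qed
  obtain \<Omega>' Z \<rho> where \<rho>: "open \<Omega>'" "\<phi> p \<in> \<Omega>'" "\<Omega>' \<subseteq> \<Omega>" "open Z" "smooth_on Z \<rho>" "\<rho> ` Z \<subseteq> \<Omega>'"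
    "\<And>x. x \<in> \<Omega>' \<Longrightarrow> F x \<in> Z \<and> \<rho> (F x) = x"
    by (rule smooth_on_local_left_inverse[OF o\<Omega> F p\<Omega> inj], rule that)
  define W where "W = inv_into W0 \<psi> ` (\<psi> ` W0 \<inter> Z)"
  have W_eq: "W = {q \<in> W0. \<psi> q \<in> Z}"
    using smooth_atlas_inv_into[OF A' c'(1)] by (force simp: W_def)
  have "continuous_on W0 \<psi>"
    using smooth_atlas_chart(3)[OF A' c'(1)] by (simp add: homeomorphism_def)
  then have oW: "open W"
    unfolding W_eq using continuous_open_preimage[OF _ smooth_atlas_chart(1)[OF A' c'(1)] \<rho>(4)]
    by (simp add: vimage_def Int_def)
  have WW0: "W \<subseteq> W0" and \<psi>W: "\<psi> ` W \<subseteq> Z" by (auto simp: W_eq)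
  have o\<psi>W: "open (\<psi> ` W)"
    using smooth_atlas_open_image[OF A' c'(1) oW] WW0 by (simp add: Int_absorb1)
  \<comment> \<open>\<open>G\<close> is the neighbourhood of \<open>p\<close> on which
    \<open>\<rho> (\<psi> (\<iota> q))\<close> returns the coordinates of \<open>q\<close>; there
    the extension will restrict to the push-forward of the given field.\<close>
  define G where "G = {q \<in> U0. \<phi> q \<in> \<Omega>'}"
  have "continuous_on U0 \<phi>"
    using smooth_atlas_chart(3)[OF A c(1)] by (simp add: homeomorphism_def)
  then have oG: "open G"
    unfolding G_def using continuous_open_preimage[OF _ smooth_atlas_chart(1)[OF A c(1)] \<rho>(1)]
    by (simp add: vimage_def Int_def)
  have G: "q \<in> U0" "q \<in> U" "\<iota> q \<in> W" "\<rho> (\<psi> (\<iota> q)) = \<phi> q" if "q \<in> G" for q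
  proof -
    show q: "q \<in> U0" using that by (simp add: G_def)
    have "\<phi> q \<in> \<Omega>" using that \<rho>(3) by (auto simp: G_def)
    then obtain q' where q': "q' \<in> U0" "\<iota> q' \<in> W0" "q' \<in> U" "\<phi> q = \<phi> q'" by (auto simp: \<Omega>_def)
    have "q = q'" using smooth_atlas_inv_into[OF A c(1)] q q' by metis
    with q' have "\<iota> q \<in> W0" and "q \<in> U" by simp_all
    moreover have Fq: "F (\<phi> q) = \<psi> (\<iota> q)" by (simp add: F_def smooth_atlas_inv_into[OF A c(1) q])
    moreover have "F (\<phi> q) \<in> Z \<and> \<rho> (F (\<phi> q)) = \<phi> q" using \<rho>(7) that by (simp add: G_def)
    ultimately show "q \<in> U" "\<iota> q \<in> W" "\<rho> (\<psi> (\<iota> q)) = \<phi> q" by (auto simp: W_eq)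
  qed
  have pG: "p \<in> G" using c(2) \<rho>(2) by (simp add: G_def)
  show ?thesis
  proof (rule that[OF oW G(3)[OF pG]])
    fix X assume X: "vector_field_on A U X"
    obtain u where u: "smooth_on (\<phi> ` (U0 \<inter> U)) u"
      "\<And>q. q \<in> U0 \<inter> U \<Longrightarrow> X q = chart_vector A (U0, \<phi>) q (u (\<phi> q))"
      by (rule vector_field_on_chart_coordinates[OF A c(1) U(1) X], rule that)
    \<comment> \<open>The components of the push-forward, F'(x) u(x), are evaluated at x =
      \<rho>(\<psi>(q)), which makes sense also for points of \<open>W\<close> off the image of
      \<iota>.\<close>
    define X' where "X' = (\<lambda>q. chart_vector A' (W0, \<psi>) q
      ((\<lambda>x. frechet_derivative F (at x) (u x)) (\<rho> (\<psi> q))))"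
    have "smooth_on \<Omega> (\<lambda>x. frechet_derivative F (at x) (u x))"
      by (rule smooth_on_frechet_derivative_apply[OF o\<Omega> F smooth_on_subset[OF u(1)]]) (auto simp: \<Omega>_def)
    from smooth_on_compose[OF o\<psi>W o\<Omega> _ this smooth_on_subset[OF \<rho>(5) \<psi>W]]
    have "smooth_on (\<psi> ` W) (\<lambda>y. (\<lambda>x. frechet_derivative F (at x) (u x)) (\<rho> y))"
      using \<rho>(3,6) \<psi>W by blast
    then have "vector_field_on A' W X'"
      unfolding X'_def by (rule vector_field_on_chart_vector[OF A' c'(1) oW WW0])
    moreover have "X' (\<iota> q) = tangent_map A' \<iota> q (X q)" if "q \<in> G" for q
      using G[OF that] WW0 by (auto simp: X'_def u(2) dF)
    ultimately show "\<exists>X'. vector_field_on A' W X' \<and> related_near A' \<iota> p X X'"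
      unfolding related_near_def using oG pG by blast
  qed
qed

section \<open>Exterior derivatives and the Gauss formula\<close>

lemma one_form_smooth:
  assumes "one_form A \<theta>" "open U" "vector_field_on A U X"
  shows "smooth_fun A U (\<lambda>p. \<theta> p (X p))"
proof -
  have "\<forall>U X. open U \<and> vector_field_on A U X \<longrightarrow> smooth_fun A U (\<lambda>p. \<theta> p (X p))"
    using assms(1) unfolding one_form_def by (rule conjunct2)
  with assms(2,3) show ?thesis by simp
qed

text \<open>A torsion-free connection writes the bracket as a difference of two covariant
  derivatives, which are tangent; this avoids a computation in coordinates.\<close>

lemma lie_bracket_tangent_space:
  assumes "smooth_atlas A" "connection A D" "torsion_free A D"
    and "open U" "vector_field_on A U X" "vector_field_on A U Y" "p \<in> U"
  shows "lie_bracket A X Y p \<in> tangent_space A p"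
proof -
  have "vector_field_on A U (D X Y)" "vector_field_on A U (D Y X)"
    using assms(2,4-6) smooth_fun_const[OF assms(1,4), of 0] unfolding connection_def by blast+
  then have "D X Y p - D Y X p \<in> tangent_space A p"
    using assms(7) by (intro subspace_diff[OF subspace_tangent_space[OF assms(1)]] vector_field_onD(1))
  moreover have "D X Y p - D Y X p = lie_bracket A X Y p"
    using assms(3-7) unfolding torsion_free_def by blast
  ultimately show ?thesis by simp
qed

text \<open>A one-form is a total function on functionals, with arbitrary values off the tangent
  spaces. The tangency of the bracket makes the last term of the exterior derivative insensitive to
  those values.\<close>

lemma ext_deriv_cong:
  assumes A: "smooth_atlas A" and U: "open U" and X: "vector_field_on A U X" and Y: "vector_field_on A U Y"
    and p: "p \<in> U" and br: "lie_bracket A X Y p \<in> tangent_space A p"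
    and eq: "\<And>q v. v \<in> tangent_space A q \<Longrightarrow> \<theta> q v = \<theta>' q v"
  shows "ext_deriv A \<theta> X Y p = ext_deriv A \<theta>' X Y p"
proof -
  have "X p (\<lambda>q. \<theta> q (Y q)) = X p (\<lambda>q. \<theta>' q (Y q))"
    by (rule tangent_vector_local[OF A vector_field_onD(1)[OF X p] U p]) (rule eq[OF vector_field_onD(1)[OF Y]])
  moreover have "Y p (\<lambda>q. \<theta> q (X q)) = Y p (\<lambda>q. \<theta>' q (X q))"
    by (rule tangent_vector_local[OF A vector_field_onD(1)[OF Y p] U p]) (rule eq[OF vector_field_onD(1)[OF X]])
  ultimately show ?thesis unfolding ext_deriv_def by (simp add: eq[OF br])
qed

text \<open>This is d(df) = 0: the bracket applied to \<open>f\<close> is by definition the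
  commutator that the other two terms produce.\<close>

lemma ext_deriv_add_differential:
  assumes A: "smooth_atlas A" and U: "open U" and X: "vector_field_on A U X" and Y: "vector_field_on A U Y"
    and p: "p \<in> U" and f: "smooth_near A p f"
    and \<theta>: "smooth_near A p (\<lambda>q. \<theta> q (X q))" "smooth_near A p (\<lambda>q. \<theta> q (Y q))"
  shows "ext_deriv A (\<lambda>q v. \<theta> q v + v f) X Y p = ext_deriv A \<theta> X Y p"
proof -
  have "X p (\<lambda>q. \<theta> q (Y q) + Y q f) = X p (\<lambda>q. \<theta> q (Y q)) + X p (\<lambda>q. Y q f)"
    by (rule tangent_vector_add[OF A vector_field_onD(1)[OF X p] \<theta>(2) vector_field_on_smooth_near[OF Y U p f]])
  moreover have "Y p (\<lambda>q. \<theta> q (X q) + X q f) = Y p (\<lambda>q. \<theta> q (X q)) + Y p (\<lambda>q. X q f)"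
    by (rule tangent_vector_add[OF A vector_field_onD(1)[OF Y p] \<theta>(1) vector_field_on_smooth_near[OF X U p f]])
  moreover have "lie_bracket A X Y p f = X p (\<lambda>q. Y q f) - Y p (\<lambda>q. X q f)"
    using f by (simp add: lie_bracket_def)
  ultimately show ?thesis unfolding ext_deriv_def by simp
qed

text \<open>Compatibility expands X(g(Y, V)) and Y(g(X, V)). By torsion-freeness the terms with D_X
  Y and D_Y X cancel against the bracket, leaving g(Y, D_X V) - g(X, D_Y V).\<close>

lemma ext_deriv_metric_dual:
  assumes conn: "connection A D" "torsion_free A D" "metric_compatible A g D" and A: "smooth_atlas A"
    and sym: "\<And>p u v. u \<in> tangent_space A p \<Longrightarrow> v \<in> tangent_space A p \<Longrightarrow> g p u v = g p v u"
    and lin: "\<And>p a u v w. \<lbrakk>u \<in> tangent_space A p; v \<in> tangent_space A p; w \<in> tangent_space A p\<rbrakk> \<Longrightarrow>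
        g p (a *\<^sub>R u + v) w = a * g p u w + g p v w"
    and U: "open U" and X: "vector_field_on A U X" and Y: "vector_field_on A U Y" and V: "vector_field_on A U V"
    and p: "p \<in> U" and DXV: "D X V p = a *\<^sub>R V p" and DYV: "D Y V p = b *\<^sub>R V p"
  shows "ext_deriv A (\<lambda>p v. g p v (V p)) X Y p = a * g p (Y p) (V p) - b * g p (X p) (V p)"
proof -
  note T = subspace_tangent_space[OF A, of p]
  have D: "D Z Z' p \<in> tangent_space A p" if "vector_field_on A U Z" "vector_field_on A U Z'" for Z Z'
  proof -
    have "vector_field_on A U (D Z Z')"
      using conn(1) U that smooth_fun_const[OF A U, of 0] unfolding connection_def by blast
    then show ?thesis by (rule vector_field_onD(1)[OF _ p])
  qed
  note XpT = vector_field_onD(1)[OF X p] and YpT = vector_field_onD(1)[OF Y p] and VpT = vector_field_onD(1)[OF V p]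
  \<comment> \<open>Linearity with coefficient 1 at zero vectors says that this value equals its own
    double.\<close>
  have lin0: "g p 0 w = 0" if "w \<in> tangent_space A p" for w
    using lin[of 0 p 0 w 1] that subspace_0[OF T] by simp
  have scal: "g p u (c *\<^sub>R w) = c * g p u w" if "u \<in> tangent_space A p" "w \<in> tangent_space A p" for c u w
    using lin[of w p 0 u c] that subspace_0[OF T] lin0[of u] sym[of u p w] sym[of u p "c *\<^sub>R w"] subspace_scale[OF T, of w c]
    by simp
  have "X p (\<lambda>q. g q (Y q) (V q)) = g p (D X Y p) (V p) + g p (Y p) (D X V p)"
    using conn(3) U X Y V p unfolding metric_compatible_def cov_deriv_metric_def by (fastforce simp: algebra_simps)
  moreover have "Y p (\<lambda>q. g q (X q) (V q)) = g p (D Y X p) (V p) + g p (X p) (D Y V p)"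
    using conn(3) U X Y V p unfolding metric_compatible_def cov_deriv_metric_def by (fastforce simp: algebra_simps)
  moreover have "lie_bracket A X Y p = (-1) *\<^sub>R D Y X p + D X Y p"
    using conn(2) U X Y p unfolding torsion_free_def by fastforce
  moreover have "g p ((-1) *\<^sub>R D Y X p + D X Y p) (V p) = (-1) * g p (D Y X p) (V p) + g p (D X Y p) (V p)"
    by (rule lin[OF D[OF Y X] D[OF X Y] VpT])
  ultimately show ?thesis
    unfolding ext_deriv_def by (simp only: DXV DYV scal XpT YpT VpT)
qed

text \<open>Linearity of endomorphism fields and connections is stated for combinations a u + v;
  this presents -w in that form.\<close>

lemma scaleR_minus2_add: "(-2) *\<^sub>R w + w = - w" for w :: "'v::real_vector"
  using scaleR_left_distrib[of "-2" 1 w] by simp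

lemma endo_field_minus:
  assumes J: "endo_field A J" and u: "u \<in> tangent_space A p"
  shows "J p (- u) = - J p u"
proof -
  have "J p ((-2) *\<^sub>R u + u) = (-2) *\<^sub>R J p u + J p u"
    using J u unfolding endo_field_def by blast
  then show ?thesis by (simp only: scaleR_minus2_add)
qed

text \<open>The field \<open>- Y\<close> is written so that a single instance of the Leibniz rule in \<open>connection\<close>, with a
  constant coefficient and without the zero field, suffices.\<close>

lemma connection_minus:
  assumes A: "smooth_atlas A" and D: "connection A D" and U: "open U"
    and X: "vector_field_on A U X" and Y: "vector_field_on A U Y" and p: "p \<in> U"
  shows "D X (\<lambda>q. (-2) *\<^sub>R Y q + Y q) p = - D X Y p"
proof -
  have "D X (\<lambda>q. (-2) *\<^sub>R Y q + Y q) p = (-2) *\<^sub>R D X Y p + X p (\<lambda>q. -2) *\<^sub>R Y p + D X Y p"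
    using D U X Y p smooth_fun_const[OF A U, of "-2"] unfolding connection_def by blast
  also have "X p (\<lambda>q. -2) = 0" by (rule tangent_vector_const[OF A vector_field_onD(1)[OF X p]])
  finally show ?thesis by (simp only: scaleR_zero_left add_0_right scaleR_minus2_add)
qed

text \<open>After extension to the ambient manifold, V becomes J applied to the extension of -\<xi>.
  Parallelism pulls J out of the derivative, B = 0 identifies ambient with induced derivatives, and
  injectivity of the tangent map brings the equation back to the hypersurface.\<close>

lemma gauss_formula_J:
  assumes A: "smooth_atlas A" and A': "smooth_atlas A'" and imm: "immersion A A' \<iota>"
    and nabla: "connection A' nabla" "parallel_endo A' nabla J" "endo_field A' J"
    and D: "induced_connection A A' \<iota> nabla N D B" "totally_geodesic A B"
    and U: "open U" "p \<in> U" and X: "vector_field_on A U X"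
    and \<xi>: "vector_field_on A U \<xi>" and V: "vector_field_on A U V"
    and VJ: "\<And>q. tangent_map A' \<iota> q (V q) = - J (\<iota> q) (tangent_map A' \<iota> q (\<xi> q))"
    and D\<xi>: "D X \<xi> p = a *\<^sub>R \<xi> p"
  shows "D X V p = a *\<^sub>R V p"
proof -
  have \<iota>: "smooth_map A A' \<iota>" using imm unfolding immersion_def by blast
  obtain W where W: "open W" "\<iota> p \<in> W"
    "\<And>X. vector_field_on A U X \<Longrightarrow> \<exists>X'. vector_field_on A' W X' \<and> related_near A' \<iota> p X X'"
    by (rule immersion_extend_vector_field[OF A A' imm U], rule that)
  obtain X' where X': "vector_field_on A' W X'" "related_near A' \<iota> p X X'" using W(3)[OF X] by blast
  obtain \<xi>' where \<xi>': "vector_field_on A' W \<xi>'" "related_near A' \<iota> p \<xi> \<xi>'" using W(3)[OF \<xi>] by blast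
  define \<zeta> where "\<zeta> = (\<lambda>q. (-2) *\<^sub>R \<xi>' q + \<xi>' q)"
  have \<zeta>: "vector_field_on A' W \<zeta>"
    unfolding \<zeta>_def by (rule vector_field_on_linear[OF A' W(1) smooth_fun_const[OF A' W(1)] \<xi>'(1) \<xi>'(1)])
  have \<zeta>_eq: "\<zeta> q = - \<xi>' q" for q unfolding \<zeta>_def by (rule scaleR_minus2_add)
  \<comment> \<open>\<open>V'\<close> is not an arbitrary extension of \<open>V\<close>: it has the
    form J(\<zeta>), so that parallelism of J applies to it directly.\<close>
  define V' where "V' = (\<lambda>q. J q (\<zeta> q))"
  have V': "vector_field_on A' W V'"
    using nabla(3) \<zeta> W(1) unfolding V'_def endo_field_def by blast
  have T: "\<xi> q \<in> tangent_space A q" if "q \<in> U" for q by (rule vector_field_onD(1)[OF \<xi> that])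
  have relV: "related_near A' \<iota> p V V'"
  proof -
    obtain G where G: "open G" "p \<in> G" "\<And>q. q \<in> G \<Longrightarrow> \<xi>' (\<iota> q) = tangent_map A' \<iota> q (\<xi> q)"
      using \<xi>'(2) unfolding related_near_def by blast
    have "V' (\<iota> q) = tangent_map A' \<iota> q (V q)" if "q \<in> G \<inter> U" for q
      using G(3)[of q] that endo_field_minus[OF nabla(3) tangent_map_tangent_space[OF A A' \<iota> T]]
      by (simp add: V'_def \<zeta>_eq VJ)
    then show ?thesis unfolding related_near_def using G U by (intro exI[of _ "G \<inter> U"]) auto
  qed
  have gauss: "nabla X' Y' (\<iota> p) = tangent_map A' \<iota> p (D X Y p)"
    if "vector_field_on A U Y" "vector_field_on A' W Y'" "related_near A' \<iota> p Y Y'" for Y Y'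
  proof -
    have "nabla X' Y' (\<iota> p) = tangent_map A' \<iota> p (D X Y p) + B p (X p) (Y p) *\<^sub>R N p"
      using D(1) U X that W(1,2) X' unfolding induced_connection_def by blast
    moreover have "B p (X p) (Y p) = 0"
      using D(2) vector_field_onD(1)[OF X U(2)] vector_field_onD(1)[OF that(1) U(2)]
      unfolding totally_geodesic_def by blast
    ultimately show ?thesis by simp
  qed
  have tm_scale: "tangent_map A' \<iota> p (c *\<^sub>R u) = c *\<^sub>R tangent_map A' \<iota> p u" for c u
    by (simp add: tangent_map_def scaleR_fun_def fun_eq_iff)
  let ?w = "tangent_map A' \<iota> p (\<xi> p)"
  have w: "?w \<in> tangent_space A' (\<iota> p)" by (rule tangent_map_tangent_space[OF A A' \<iota> T[OF U(2)]])
  have "tangent_map A' \<iota> p (D X V p) = nabla X' V' (\<iota> p)" by (rule gauss[OF V V' relV, symmetric])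
  also have "\<dots> = J (\<iota> p) (nabla X' \<zeta> (\<iota> p))"
    using nabla(2) W(1,2) X'(1) \<zeta> unfolding V'_def parallel_endo_def by blast
  also have "nabla X' \<zeta> (\<iota> p) = - nabla X' \<xi>' (\<iota> p)"
    unfolding \<zeta>_def by (rule connection_minus[OF A' nabla(1) W(1) X'(1) \<xi>'(1) W(2)])
  also have "nabla X' \<xi>' (\<iota> p) = a *\<^sub>R ?w"
    using gauss[OF \<xi> \<xi>'] by (simp add: D\<xi> tm_scale)
  also have "J (\<iota> p) (- (a *\<^sub>R ?w)) = a *\<^sub>R J (\<iota> p) (- ?w)"
  proof -
    have J_lin: "J (\<iota> p) (c *\<^sub>R u + v) = c *\<^sub>R J (\<iota> p) u + J (\<iota> p) v"
      if "u \<in> tangent_space A' (\<iota> p)" "v \<in> tangent_space A' (\<iota> p)" for c u v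
      using nabla(3) that unfolding endo_field_def by blast
    \<comment> \<open>The scalar multiple is rewritten as a combination c u + v with u and v being w
      and -w, to which the linearity of J applies.\<close>
    have "- (a *\<^sub>R ?w) = (1 - a) *\<^sub>R ?w + (- ?w)" by (simp add: algebra_simps)
    then show ?thesis
      using J_lin[OF w, of "- ?w" "1 - a"] w subspace_neg[OF subspace_tangent_space[OF A']]
        endo_field_minus[OF nabla(3) w] by (simp add: algebra_simps)
  qed
  also have "J (\<iota> p) (- ?w) = tangent_map A' \<iota> p (V p)"
    by (simp add: endo_field_minus[OF nabla(3) w] VJ)
  also have "a *\<^sub>R tangent_map A' \<iota> p (V p) = tangent_map A' \<iota> p (a *\<^sub>R V p)" by (simp add: tm_scale)
  finally have "tangent_map A' \<iota> p (D X V p) = tangent_map A' \<iota> p (a *\<^sub>R V p)" .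
  moreover have "inj_on (tangent_map A' \<iota> p) (tangent_space A p)" using imm unfolding immersion_def by blast
  moreover have "D X V p \<in> tangent_space A p"
  proof -
    have "connection A D" using D(1) unfolding induced_connection_def by blast
    then have "vector_field_on A U (D X V)"
      using U X V smooth_fun_const[OF A U(1), of 0] unfolding connection_def by blast
    then show ?thesis by (rule vector_field_onD(1)[OF _ U(2)])
  qed
  moreover have "a *\<^sub>R V p \<in> tangent_space A p"
    using subspace_scale[OF subspace_tangent_space[OF A] vector_field_onD(1)[OF V U(2)]] .
  ultimately show ?thesis by (metis inj_onD)
qed

lemma sym_tensor_commute:
  assumes "sym_tensor A g" "u \<in> tangent_space A p" "v \<in> tangent_space A p"
  shows "g p u v = g p v u"
proof -
  have "\<forall>p. \<forall>u\<in>tangent_space A p. \<forall>v\<in>tangent_space A p. g p u v = g p v u"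
    using assms(1) unfolding sym_tensor_def by (rule conjunct1)
  then show ?thesis using assms(2,3) by simp
qed

lemma sym_tensor_linear:
  assumes "sym_tensor A g" "u \<in> tangent_space A p" "v \<in> tangent_space A p" "w \<in> tangent_space A p"
  shows "g p (a *\<^sub>R u + v) w = a * g p u w + g p v w"
  using assms unfolding sym_tensor_def by blast

text \<open>The witness is \<open>J N\<close>.\<close>

lemma ex_screen_vector_pairing_V:
  assumes A: "smooth_atlas A" and A': "smooth_atlas A'" and imm: "immersion A A' \<iota>"
    and g: "sym_tensor A' g" and J: "endo_field A' J"
    and orth: "\<And>p u v. u \<in> tangent_space A' p \<Longrightarrow> v \<in> tangent_space A' p \<Longrightarrow> g p (J p u) (J p v) = g p u v"
    and scr: "screen_distribution A (induced_metric A' \<iota> g) S" "transversal_section A' g \<iota> S \<xi> N"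
      "screen_splitting A A' \<iota> g J N S D\<^sub>0"
    and \<xi>: "\<xi> p \<in> tangent_space A p"
    and VJ: "tangent_map A' \<iota> p (V p) = - J (\<iota> p) (tangent_map A' \<iota> p (\<xi> p))"
  shows "\<exists>w\<in>tangent_space A p. induced_metric A' \<iota> g p w (V p) = - 1"
proof -
  have \<iota>: "smooth_map A A' \<iota>" using imm unfolding immersion_def by blast
  note T = subspace_tangent_space[OF A] and T' = subspace_tangent_space[OF A']
  let ?x = "tangent_map A' \<iota> p (\<xi> p)"
  have x: "?x \<in> tangent_space A' (\<iota> p)" by (rule tangent_map_tangent_space[OF A A' \<iota> \<xi>])
  have N: "N p \<in> tangent_space A' (\<iota> p)" "g (\<iota> p) (N p) ?x = 1"
    using scr(2) unfolding transversal_section_def by auto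
  have tm0: "tangent_map A' \<iota> p 0 = 0" by (simp add: tangent_map_def fun_eq_iff)
  have J0: "J (\<iota> p) 0 = 0"
  proof -
    have "J (\<iota> p) (- 0) = - J (\<iota> p) 0" by (rule endo_field_minus[OF J subspace_0[OF T']])
    then show ?thesis by (simp add: eq_neg_iff_add_eq_0 scaleR_2[symmetric])
  qed
  note g_sym = sym_tensor_commute[OF g] and g_lin = sym_tensor_linear[OF g]
  have g0: "g (\<iota> p) 0 w = 0" if "w \<in> tangent_space A' (\<iota> p)" for w
    using g_lin[of 0 _ 0 w 1] that subspace_0[OF T'] by simp
  \<comment> \<open>J N has to be recognised as 0 + J N + 0 in the splitting of the screen, so zero
    must be placed in the first and third summands.\<close>
  have "0 \<in> metric_radical A (induced_metric A' \<iota> g) p"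
    unfolding metric_radical_def induced_metric_def
    using subspace_0[OF T] g0 tangent_map_tangent_space[OF A A' \<iota>] by (simp add: tm0)
  then have 1: "0 \<in> (\<lambda>u. J (\<iota> p) (tangent_map A' \<iota> p u)) ` metric_radical A (induced_metric A' \<iota> g) p"
    by (rule rev_image_eqI) (simp add: tm0 J0)
  have "\<exists>B. D\<^sub>0 p = span B"
    using scr(3) unfolding screen_splitting_def distribution_def by blast
  then have "0 \<in> D\<^sub>0 p" using span_zero by metis
  then have 2: "0 \<in> tangent_map A' \<iota> p ` D\<^sub>0 p" by (rule rev_image_eqI) (simp add: tm0)
  have 3: "J (\<iota> p) (N p) \<in> J (\<iota> p) ` span {N p}" by (simp add: span_base)
  have "tangent_map A' \<iota> p ` S p = {x + y + z | x y z.
      x \<in> (\<lambda>u. J (\<iota> p) (tangent_map A' \<iota> p u)) ` metric_radical A (induced_metric A' \<iota> g) p \<and>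
      y \<in> J (\<iota> p) ` span {N p} \<and> z \<in> tangent_map A' \<iota> p ` D\<^sub>0 p}"
    using scr(3) unfolding screen_splitting_def by (simp add: Let_def)
  moreover have "0 + J (\<iota> p) (N p) + 0 \<in> \<dots>" using 1 2 3 by blast
  ultimately have "J (\<iota> p) (N p) \<in> tangent_map A' \<iota> p ` S p" by simp
  then obtain w where w: "w \<in> S p" "tangent_map A' \<iota> p w = J (\<iota> p) (N p)" by (metis imageE)
  \<comment> \<open>Screen vectors are known to be tangent only through the decomposition of the
    tangent space into screen plus radical.\<close>
  have "w + 0 \<in> {x + y | x y. x \<in> S p \<and> y \<in> metric_radical A (induced_metric A' \<iota> g) p}"
    using w(1) \<open>0 \<in> metric_radical A _ p\<close> by blast
  then have wT: "w \<in> tangent_space A p"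
    using scr(1) unfolding screen_distribution_def by simp
  \<comment> \<open>Orthogonality of J turns the pairing of J N with J(-\<xi>) into that of N with
    -\<xi>, which is -1 by the normalisation of N.\<close>
  have "induced_metric A' \<iota> g p w (V p) = g (\<iota> p) (J (\<iota> p) (N p)) (- J (\<iota> p) ?x)"
    by (simp add: induced_metric_def w VJ)
  also have "- J (\<iota> p) ?x = J (\<iota> p) (- ?x)" by (rule endo_field_minus[OF J x, symmetric])
  also have "g (\<iota> p) (J (\<iota> p) (N p)) (J (\<iota> p) (- ?x)) = g (\<iota> p) (N p) (- ?x)"
    by (rule orth[OF N(1) subspace_neg[OF T' x]])
  also have "\<dots> = g (\<iota> p) ((-2) *\<^sub>R ?x + ?x) (N p)"
    using g_sym[OF N(1) subspace_neg[OF T' x]] by (simp only: scaleR_minus2_add)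
  also have "\<dots> = - 1"
    using g_lin[OF x x N(1), of "-2"] g_sym[OF N(1) x] N(2) by simp
  finally show ?thesis using wT by blast
qed

theorem theorem6p1:
  fixes Abar :: "('a::{t2_space, second_countable_topology}, 'e::euclidean_space) atlas"
    and A :: "('b::{t2_space, second_countable_topology}, 'f::euclidean_space) atlas"
    and m \<nu> :: nat
    and gbar :: "'a form2" and Jbar :: "'a \<Rightarrow> 'a tangent \<Rightarrow> 'a tangent" and nabla :: "'a conn"
    and \<iota> :: "'b \<Rightarrow> 'a" and g\<^sub>0 :: "'b form2"
    and S D\<^sub>0 :: "'b \<Rightarrow> 'b tangent set"
    and \<xi> V :: "'b vfield" and N :: "'b \<Rightarrow> 'a tangent"
    and \<theta>\<^sub>0 \<eta> \<phi> :: "'b form1" and B :: "'b form2"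
    and Dg\<^sub>0 DJ :: "'b conn"
  assumes \<comment> \<open>the ambient indefinite Kaehler manifold\<close>
    ambient: "smooth_atlas Abar" "DIM('e) = 2 * m" "m > 1" "0 < \<nu>" "\<nu> < m"
      "indefinite_kaehler Abar gbar Jbar nabla (2 * \<nu>)"
    \<comment> \<open>the lightlike hypersurface\<close>
    and hypersurface: "smooth_atlas A" "DIM('f) = 2 * m - 1" "immersion A Abar \<iota>"
      "g\<^sub>0 = induced_metric Abar \<iota> gbar" "lightlike A g\<^sub>0"
    and xi: "vector_field_on A UNIV \<xi>" "\<And>p. \<xi> p \<noteq> 0" "\<And>p. \<xi> p \<in> metric_radical A g\<^sub>0 p"
    \<comment> \<open>screen distribution and transversal bundle\<close>
    and screen: "screen_distribution A g\<^sub>0 S" "transversal_section Abar gbar \<iota> S \<xi> N"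
      "screen_splitting A Abar \<iota> gbar Jbar N S D\<^sub>0"
    and V: "vector_field_on A UNIV V"
      "\<And>p. tangent_map Abar \<iota> p (V p) = - Jbar (\<iota> p) (tangent_map Abar \<iota> p (\<xi> p))"
    and forms: "\<theta>\<^sub>0 = (\<lambda>p v. g\<^sub>0 p v (V p))"
      "\<eta> = (\<lambda>p v. gbar (\<iota> p) (N p) (tangent_map Abar \<iota> p v))"
    \<comment> \<open>induced connection, total geodesy, and the form it defines\<close>
    and induced: "induced_connection A Abar \<iota> nabla N Dg\<^sub>0 B" "totally_geodesic A B"
    and phi: "one_form A \<phi>"
      "\<And>U X p. open U \<Longrightarrow> p \<in> U \<Longrightarrow> vector_field_on A U X \<Longrightarrow> Dg\<^sub>0 X \<xi> p = \<phi> p (X p) *\<^sub>R \<xi> p"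
    and sff: "screen_sff_symmetric A g\<^sub>0 S \<xi> Dg\<^sub>0"
    \<comment> \<open>the Weyl screen structure with associated forms \<open>\<theta>\<^sub>0 + df\<close>\<close>
    and DJ: "weyl_screen_structure A g\<^sub>0 S DJ"
      "\<And>f. conformal_exponent A g\<^sub>0 f \<Longrightarrow>
        weyl_form A DJ (rescale f g\<^sub>0) (\<lambda>p v. \<theta>\<^sub>0 p v + v f)"
      "weyl_J_structure A g\<^sub>0 S \<xi> \<eta> \<theta>\<^sub>0 Dg\<^sub>0 DJ"
  shows "weyl_closed A (conformal_class A g\<^sub>0) DJ \<longleftrightarrow>
    (\<exists>k. smooth_fun A UNIV k \<and> (\<forall>p. \<forall>v\<in>tangent_space A p. \<phi> p v = k p * \<theta>\<^sub>0 p v))"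
proof -
  have imm: "smooth_map A Abar \<iota>" using hypersurface(3) unfolding immersion_def by blast
  have gbar: "sym_tensor Abar gbar" and nabla: "levi_civita Abar gbar nabla" "parallel_endo Abar nabla Jbar"
    and J: "endo_field Abar Jbar"
    and orth: "\<And>p u v. u \<in> tangent_space Abar p \<Longrightarrow> v \<in> tangent_space Abar p \<Longrightarrow> gbar p (Jbar p u) (Jbar p v) = gbar p u v"
    using ambient(6) unfolding indefinite_kaehler_def semi_riemannian_def by auto
  have nabla_conn: "connection Abar nabla" using nabla(1) unfolding levi_civita_def by blast
  note A = hypersurface(1) and A' = ambient(1)
  note tmT = tangent_map_tangent_space[OF A A' imm]
  have g0: "g\<^sub>0 p u v = gbar (\<iota> p) (tangent_map Abar \<iota> p u) (tangent_map Abar \<iota> p v)" for p u v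
    by (simp add: hypersurface(4) induced_metric_def)
  have g0_sym: "g\<^sub>0 p u v = g\<^sub>0 p v u" if "u \<in> tangent_space A p" "v \<in> tangent_space A p" for p u v
    unfolding g0 by (rule sym_tensor_commute[OF gbar tmT[OF that(1)] tmT[OF that(2)]])
  have g0_lin: "g\<^sub>0 p (a *\<^sub>R u + v) w = a * g\<^sub>0 p u w + g\<^sub>0 p v w"
    if "u \<in> tangent_space A p" "v \<in> tangent_space A p" "w \<in> tangent_space A p" for p a u v w
    unfolding g0 tangent_map_linear
    by (rule sym_tensor_linear[OF gbar tmT[OF that(1)] tmT[OF that(2)] tmT[OF that(3)]])
  \<comment> \<open>The zero exponent specialises the hypotheses on the conformal class to
    \<open>g\<^sub>0\<close> itself.\<close>
  have exp0: "conformal_exponent A g\<^sub>0 (\<lambda>p. 0)"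
    unfolding conformal_exponent_def metric_radical_def
    using smooth_fun_const[OF A open_UNIV] tangent_vector_const[OF A] by auto
  \<comment> \<open>The Weyl formula at the zero exponent involves a torsion-free metric connection
    that is required to be \<open>Dg\<^sub>0\<close>; this supplies its torsion-freeness and
    compatibility.\<close>
  have Dg0: "connection A Dg\<^sub>0" "torsion_free A Dg\<^sub>0" "metric_compatible A g\<^sub>0 Dg\<^sub>0"
  proof -
    have r0: "rescale (\<lambda>p. 0) g\<^sub>0 = g\<^sub>0" by (simp add: rescale_def fun_eq_iff)
    from DJ(3) exp0 obtain Dg where "connection A Dg" "torsion_free A Dg"
      "metric_compatible A (rescale (\<lambda>p. 0) g\<^sub>0) Dg" "Dg = Dg\<^sub>0"
      unfolding weyl_J_structure_def Let_def by blast
    then show "connection A Dg\<^sub>0" "torsion_free A Dg\<^sub>0" "metric_compatible A g\<^sub>0 Dg\<^sub>0" by (simp_all add: r0)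
  qed
  have DV: "Dg\<^sub>0 X V p = \<phi> p (X p) *\<^sub>R V p" if "open U" "p \<in> U" "vector_field_on A U X" for U X p
    by (rule gauss_formula_J[where D = Dg\<^sub>0 and X = X and \<xi> = \<xi> and V = V and a = "\<phi> p (X p)", OF A A' hypersurface(3) nabla_conn nabla(2) J induced that
          vector_field_on_subset[OF xi(1)] vector_field_on_subset[OF V(1)] V(2) phi(2)[OF that]]) auto
  \<comment> \<open>This is the identity d\<theta> = \<phi> \<and> \<theta> for
    \<open>\<theta>\<^sub>0\<close>, the metric dual of \<open>V\<close>.\<close>
  have d\<theta>: "ext_deriv A \<theta>\<^sub>0 X Y p = \<phi> p (X p) * \<theta>\<^sub>0 p (Y p) - \<phi> p (Y p) * \<theta>\<^sub>0 p (X p)"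
    if "open U" "vector_field_on A U X" "vector_field_on A U Y" "p \<in> U" for U X Y p
    unfolding forms(1)
    by (rule ext_deriv_metric_dual[where D = Dg\<^sub>0 and g = g\<^sub>0 and V = V and X = X and Y = Y, OF Dg0 A g0_sym g0_lin that(1-3) vector_field_on_subset[OF V(1)] that(4)
          DV[OF that(1,4,2)] DV[OF that(1,4,3)]]) auto
  \<comment> \<open>Smoothness of \<open>\<theta>\<^sub>0\<close> is taken from the associated form
    at the zero exponent, which differs from it by the derivative of a constant, zero on tangent
    vectors.\<close>
  have of0: "one_form A (\<lambda>p v. \<theta>\<^sub>0 p v + v (\<lambda>p. 0))"
    using DJ(2)[OF exp0] unfolding weyl_form_def by blast
  have \<theta>_smooth: "smooth_fun A U (\<lambda>p. \<theta>\<^sub>0 p (X p))" if U: "open U" and X: "vector_field_on A U X" for U X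
  proof (rule smooth_fun_cong[OF A U])
    show "smooth_fun A U (\<lambda>p. \<theta>\<^sub>0 p (X p) + X p (\<lambda>p. 0))"
      by (rule one_form_smooth[OF of0 U X])
    show "\<theta>\<^sub>0 p (X p) + X p (\<lambda>p. 0) = \<theta>\<^sub>0 p (X p)" if "p \<in> U" for p
      using tangent_vector_const[OF A vector_field_onD(1)[OF X that]] by simp
  qed
  \<comment> \<open>Since the right-hand side of the preceding identity depends only on values at a
    point, closedness becomes a pointwise condition once tangent vectors are extended to local
    fields.\<close>
  have closed_\<theta>0: "closed_form A \<theta>\<^sub>0 \<longleftrightarrow>
      (\<forall>p. \<forall>u\<in>tangent_space A p. \<forall>v\<in>tangent_space A p. \<phi> p u * \<theta>\<^sub>0 p v = \<phi> p v * \<theta>\<^sub>0 p u)"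
  proof (intro iffI allI ballI)
    fix p u v assume cl: "closed_form A \<theta>\<^sub>0" and u: "u \<in> tangent_space A p" and v: "v \<in> tangent_space A p"
    obtain U X where X: "open U" "p \<in> U" "vector_field_on A U X" "X p = u" by (rule tangent_vector_extend[OF A u], rule that)
    obtain W Y where Y: "open W" "p \<in> W" "vector_field_on A W Y" "Y p = v" by (rule tangent_vector_extend[OF A v], rule that)
    have UW: "open (U \<inter> W)" "p \<in> U \<inter> W" and XY: "vector_field_on A (U \<inter> W) X" "vector_field_on A (U \<inter> W) Y"
      using X Y by (auto intro: vector_field_on_subset)
    have "ext_deriv A \<theta>\<^sub>0 X Y p = 0" using cl UW XY unfolding closed_form_def by blast
    then show "\<phi> p u * \<theta>\<^sub>0 p v = \<phi> p v * \<theta>\<^sub>0 p u" using d\<theta>[OF UW(1) XY UW(2)] X(4) Y(4) by simp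
  next
    assume *: "\<forall>p. \<forall>u\<in>tangent_space A p. \<forall>v\<in>tangent_space A p. \<phi> p u * \<theta>\<^sub>0 p v = \<phi> p v * \<theta>\<^sub>0 p u"
    show "closed_form A \<theta>\<^sub>0"
      unfolding closed_form_def
    proof (intro allI impI ballI, elim conjE)
      fix U X Y p assume h: "open U" "vector_field_on A U X" "vector_field_on A U Y" "p \<in> U"
      show "ext_deriv A \<theta>\<^sub>0 X Y p = 0"
        using d\<theta>[OF h] * vector_field_onD(1)[OF h(2,4)] vector_field_onD(1)[OF h(3,4)] by simp
    qed
  qed
  \<comment> \<open>Agreement is assumed on tangent vectors only, because uniqueness of the
    associated form gives no more.\<close>
  have closed_shift: "closed_form A \<theta> \<longleftrightarrow> closed_form A \<theta>\<^sub>0"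
    if f: "conformal_exponent A g\<^sub>0 f" and \<theta>: "\<And>q v. v \<in> tangent_space A q \<Longrightarrow> \<theta> q v = \<theta>\<^sub>0 q v + v f" for \<theta> f
  proof -
    have f_near: "smooth_near A p f" for p
      using f unfolding conformal_exponent_def smooth_near_def by blast
    have "ext_deriv A \<theta> X Y p = ext_deriv A \<theta>\<^sub>0 X Y p"
      if h: "open U" "vector_field_on A U X" "vector_field_on A U Y" "p \<in> U" for U X Y p
    proof -
      have "ext_deriv A \<theta> X Y p = ext_deriv A (\<lambda>q v. \<theta>\<^sub>0 q v + v f) X Y p"
        by (rule ext_deriv_cong[OF A h lie_bracket_tangent_space[OF A Dg0(1,2) h] \<theta>])
      also have "\<dots> = ext_deriv A \<theta>\<^sub>0 X Y p"
        by (rule ext_deriv_add_differential[OF A h f_near])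
          (use \<theta>_smooth h in \<open>auto simp: smooth_near_def\<close>)
      finally show ?thesis .
    qed
    then show ?thesis unfolding closed_form_def by (intro all_cong1 imp_cong refl ball_cong) auto
  qed
  have "weyl_closed A (conformal_class A g\<^sub>0) DJ \<longleftrightarrow> closed_form A \<theta>\<^sub>0"
  proof
    assume "weyl_closed A (conformal_class A g\<^sub>0) DJ"
    then obtain g \<theta> where g: "g \<in> conformal_class A g\<^sub>0" "weyl_form A DJ g \<theta>" "closed_form A \<theta>"
      unfolding weyl_closed_def by blast
    obtain f where f: "conformal_exponent A g\<^sub>0 f" "g = rescale f g\<^sub>0"
      using g(1) unfolding conformal_class_def by blast
    have "weyl_structure A (conformal_class A g\<^sub>0) DJ"
      using DJ(1) unfolding weyl_screen_structure_def by blast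
    \<comment> \<open>Both the given closed form and the prescribed
      \<open>\<theta>\<^sub>0 + df\<close> are associated with \<open>g\<close>, so each agrees with
      \<open>\<theta>1\<close> on tangent vectors.\<close>
    then obtain \<theta>1 where \<theta>1: "\<And>\<theta>'. weyl_form A DJ g \<theta>' \<Longrightarrow> (\<forall>p. \<forall>v\<in>tangent_space A p. \<theta>' p v = \<theta>1 p v)"
      using g(1) unfolding weyl_structure_def by blast
    have "\<theta> q v = \<theta>\<^sub>0 q v + v f" if "v \<in> tangent_space A q" for q v
      using \<theta>1[OF g(2)] \<theta>1[OF DJ(2)[OF f(1), folded f(2)]] that by simp
    then show "closed_form A \<theta>\<^sub>0" using closed_shift[OF f(1)] g(3) by blast
  next
    assume "closed_form A \<theta>\<^sub>0"
    then have "closed_form A (\<lambda>p v. \<theta>\<^sub>0 p v + v (\<lambda>p. 0))" by (subst closed_shift[OF exp0]) simp_all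
    moreover have "rescale (\<lambda>p. 0) g\<^sub>0 \<in> conformal_class A g\<^sub>0" using exp0 unfolding conformal_class_def by blast
    ultimately show "weyl_closed A (conformal_class A g\<^sub>0) DJ"
      using DJ(2)[OF exp0] unfolding weyl_closed_def by blast
  qed
  also have "\<dots> \<longleftrightarrow> (\<exists>k. smooth_fun A UNIV k \<and> (\<forall>p. \<forall>v\<in>tangent_space A p. \<phi> p v = k p * \<theta>\<^sub>0 p v))"
  proof
    assume "closed_form A \<theta>\<^sub>0"
    then have wedge: "\<phi> p u * \<theta>\<^sub>0 p v = \<phi> p v * \<theta>\<^sub>0 p u"
      if "u \<in> tangent_space A p" "v \<in> tangent_space A p" for p u v
      using closed_\<theta>0 that by simp
    have "\<exists>w\<in>tangent_space A p. \<theta>\<^sub>0 p w = - 1" for p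
      unfolding forms(1) hypersurface(4)
      by (rule ex_screen_vector_pairing_V[where g = gbar and J = Jbar and \<xi> = \<xi> and V = V, OF A A' hypersurface(3) gbar J orth
          screen(1)[unfolded hypersurface(4)] screen(2,3) vector_field_onD(1)[OF xi(1) UNIV_I] V(2)])
    then obtain w where w: "\<And>p. w p \<in> tangent_space A p" "\<And>p. \<theta>\<^sub>0 p (w p) = - 1" by metis
    \<comment> \<open>Inserting \<open>w p\<close>, where \<open>\<theta>\<^sub>0\<close> is -1,
      into the wedge condition and solving for \<open>\<phi> p v\<close> gives this factor.\<close>
    define k where "k = (\<lambda>p. - \<phi> p (w p))"
    have k: "\<phi> p v = k p * \<theta>\<^sub>0 p v" if "v \<in> tangent_space A p" for p v
      using wedge[OF that w(1)] w(2)[of p] by (simp add: k_def)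
    have "smooth_fun A UNIV k"
    proof (rule smooth_fun_local[OF A])
      fix p
      obtain U X where X: "open U" "p \<in> U" "vector_field_on A U X" "X p = w p"
        by (rule tangent_vector_extend[OF A w(1)], rule that)
      \<comment> \<open>The vectors \<open>w p\<close> are chosen point by point, so smoothness of
        \<open>k\<close> is not visible from its definition. Near \<open>p\<close> a smooth field
        through \<open>w p\<close> keeps \<open>\<theta>\<^sub>0\<close> nonzero, and there
        \<open>k\<close> is the quotient of the two forms on it.\<close>
      define G where "G = {q \<in> U. \<theta>\<^sub>0 q (X q) \<noteq> 0}"
      have "open G"
        using continuous_open_preimage[OF smooth_fun_imp_continuous_on[OF A X(1) \<theta>_smooth[OF X(1,3)]] X(1), of "- {0}"]
        by (simp add: G_def vimage_def Int_def open_Compl)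
      have XG: "vector_field_on A G X" using X(3) by (rule vector_field_on_subset) (auto simp: G_def)
      have "smooth_fun A G (\<lambda>q. \<phi> q (X q) * inverse (\<theta>\<^sub>0 q (X q)))"
      proof (intro smooth_fun_mult smooth_fun_inverse A \<open>open G\<close> \<theta>_smooth XG)
        show "smooth_fun A G (\<lambda>q. \<phi> q (X q))" by (rule one_form_smooth[OF phi(1) \<open>open G\<close> XG])
      qed (simp add: G_def)
      then have "smooth_fun A G k"
      proof (rule smooth_fun_cong[OF A \<open>open G\<close>, rotated])
        fix q assume "q \<in> G"
        then show "\<phi> q (X q) * inverse (\<theta>\<^sub>0 q (X q)) = k q"
          using k[OF vector_field_onD(1)[OF XG]] by (simp add: G_def)
      qed
      moreover have "p \<in> G" using X w(2) by (simp add: G_def)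
      ultimately show "\<exists>W'. open W' \<and> p \<in> W' \<and> smooth_fun A W' k" using \<open>open G\<close> by blast
    qed
    with k show "\<exists>k. smooth_fun A UNIV k \<and> (\<forall>p. \<forall>v\<in>tangent_space A p. \<phi> p v = k p * \<theta>\<^sub>0 p v)" by blast
  next
    assume "\<exists>k. smooth_fun A UNIV k \<and> (\<forall>p. \<forall>v\<in>tangent_space A p. \<phi> p v = k p * \<theta>\<^sub>0 p v)"
    \<comment> \<open>Both products in the pointwise condition become \<open>k\<close> times the
      product of the values of \<open>\<theta>\<^sub>0\<close> on the two vectors.\<close>
    then show "closed_form A \<theta>\<^sub>0" unfolding closed_\<theta>0 by (auto simp: algebra_simps)
  qed
  finally show ?thesis .
qed

end
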